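(* Suppose $\textsc{Spec}$ is a class of specifications that supports the operations Intersection, Difference, Length Restriction, Counting, and Uniform Sampling (defined in the context, with all constructed specifications again in $\textsc{Spec}$). Suppose further that each of these operations can be done in polynomial time (polynomial expected time in the case of Uniform Sampling). Then there is a polynomial-time improvisation scheme for $\mathrm{CI}(\textsc{Spec}, \textsc{Spec})$.
   Context: A specification $\mathcal{X}$ is a finite representation of a language $L(\mathcal{X})$ over a finite alphabet $\Sigma$. Operations on a class $\textsc{Spec}$ of specifications: - Intersection: given specifications $\mathcal{X}, \mathcal{Y}$, compute a specification $\mathcal{Z}$ with $L(\mathcal{Z}) = L(\mathcal{X}) \cap L(\mathcal{Y})$. - Difference: given $\mathcal{X}, \mathcal{Y}$, compute $\mathcal{Z}$ with $L(\mathcal{Z}) = L(\mathcal{X}) \setminus L(\mathcal{Y})$. - Length Restriction: given $\mathcal{X}$ and $m,n \in \mathbb{N}$ in unary, compute $\mathcal{Y}$ with $L(\mathcal{Y}) = \{ w \in L(\mathcal{X}) : m \le |w| \le n\}$. - Counting: given $\mathcal{X}$ and a bound $n \in \mathbb{N}$ in unary on the length of strings in $L(\mathcal{X})$ (which is therefore finite), compute $|L(\mathcal{X})|$. - Uniform Sampling: given $\mathcal{X}$ and a bound $n \in \mathbb{N}$ in unary on the length of strings in $L(\mathcal{X})$, sample uniformly at random from $L(\mathcal{X})$ (when nonempty). A control improvisation (CI) instance is a tuple $\mathcal{C} = (\mathcal{H}, \mathcal{S}, m, n, \epsilon, \lambda, \rho)$ where $\mathcal{H}$ (hard specification) and $\mathcal{S}$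 (soft specification) are specifications over a common finite alphabet $\Sigma$, $m,n \in \mathbb{N}$, and $\epsilon, \lambda, \rho \in [0,1] \cap \mathbb{Q}$. Its size $|\mathcal{C}|$ is the total size of the bit representation of its parameters, with $m,n$ in unary and all other numerical parameters in binary. Put $I = \{ w \in L(\mathcal{H}) : m \le |w| \le n\}$ and $A = I \cap L(\mathcal{S})$. A probability distribution $D$ on $\Sigma^*$ is an improvising distribution for $\mathcal{C}$ if $\Pr[w \in I \mid w \leftarrow D] = 1$, $\Pr[w \in A \mid w \leftarrow D] \ge 1-\epsilon$, and $\lambda \le D(w) \le \rho$ for all $w \in I$. $\mathcal{C}$ is feasible if an improvising distribution exists. An improviser for $\mathcal{C}$ is a probabilistic algorithm with finite expected running time whose output distribution (on empty input) is an improvising distribution. $\mathrm{CI}(\mathcal{A},\mathcal{B})$ is the class of CI instances with $\mathcal{H} \in \mathcal{A}$ and $\mathcal{S} \in \mathcal{B}$. A polynomial-time improvisation scheme for a class $\mathcal{P}$ of CI instances is an algorithm $S$ such that: (correctness) for every $\mathcal{C} \in \mathcal{P}$, if $\mathcal{C}$ is feasible then $S(\mathcal{C})$ is an improviser for $\mathcal{C}$, and otherwise $S(\mathcal{C}) = \bot$; (scheme efficiency) there is a polynomial $p$ such that the running time of $S$ on every $\mathcal{C} \in \mathcal{P}$ is at most $p(|\mathcal{C}|)$; (improviser efficiency) there is a polynomial $q$ such that for every $\mathcal{C} \in \mathcal{P}$ with $S(\mathcal{C}) \ne \bot$, the improviser $S(\mathcal{C})$ has expected running time at most $q(|\mathcal{C}|)$.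 *)

theory Defs
  imports
    "HOL-Probability.Probability"
    "HOL-Probability.SPMF"
    "HOL-Library.Log_Nat"
    "HOL-Computational_Algebra.Polynomial"
begin

section \<open>Machine model\<close>

text \<open>
  Algorithms are programs of a first-order functional language over S-expressions with natural
  number atoms, under a logarithmic cost measure: every elementary step is charged the number of
  bits of the data that it reads and writes. As for the random access machine with logarithmic
  costs, whose arithmetic instructions are the ones used here, polynomial time coincides with
  polynomial time on Turing machines: every elementary step can be carried out by a Turing machine
  in time polynomial in its charge, and conversely a configuration of a Turing machine is an
  S-expression that a loop rewrites step by step. Randomness is a fair coin.
\<close>

datatype val = Num nat | VPair val val

text \<open>Up to a constant factor, the length of a self-delimiting bit representation.\<close>

primrec vsize :: "val \<Rightarrow> nat" where
  "vsize (Num k) = 1 + floorlog 2 k"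
| "vsize (VPair a b) = 1 + vsize a + vsize b"

datatype instr = Ident | Const val | Fst | Snd | IsPair | Add | Sub | Mul | Div | Less

text \<open>Instructions applied to operands of the wrong shape return \<^term>\<open>Num 0\<close>; subtraction is
  truncated at zero.\<close>

fun step :: "instr \<Rightarrow> val \<Rightarrow> val" where
  "step Ident v = v"
| "step (Const c) v = c"
| "step Fst (VPair a b) = a"
| "step Snd (VPair a b) = b"
| "step IsPair (VPair a b) = Num 1"
| "step Add (VPair (Num a) (Num b)) = Num (a + b)"
| "step Sub (VPair (Num a) (Num b)) = Num (a - b)"
| "step Mul (VPair (Num a) (Num b)) = Num (a * b)"
| "step Div (VPair (Num a) (Num b)) = Num (a div b)"
| "step Less (VPair (Num a) (Num b)) = Num (if a < b then 1 else 0)"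
| "step _ _ = Num 0"

datatype prog =
    Op instr
  | Flip
  | Seq prog prog
  | Fork prog prog
  | Cond prog prog prog
  | While prog prog

primrec flip_free :: "prog \<Rightarrow> bool" where
  "flip_free (Op i) = True"
| "flip_free Flip = False"
| "flip_free (Seq p q) = (flip_free p \<and> flip_free q)"
| "flip_free (Fork p q) = (flip_free p \<and> flip_free q)"
| "flip_free (Cond c p q) = (flip_free c \<and> flip_free p \<and> flip_free q)"
| "flip_free (While c p) = (flip_free c \<and> flip_free p)"

text \<open>
  The meaning of a program on an input is the subprobability distribution of the pairs of output
  and elapsed time; the missing mass is the probability that the program does not terminate.
  Loops are least fixed points: \<open>f\<close> is the meaning of the loop test, where
  \<^term>\<open>Num 0\<close> means exit, and \<open>g\<close> that of the loop body.
\<close>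

context
  fixes f g :: "val \<Rightarrow> (val \<times> nat) spmf"
begin

partial_function (spmf) run_while :: "val \<Rightarrow> (val \<times> nat) spmf" where
  "run_while v =
     bind_spmf (f v) (\<lambda>(b, t).
       if b = Num 0 then return_spmf (v, 1 + vsize v + t)
       else bind_spmf (g v) (\<lambda>(v', t').
         map_spmf (\<lambda>(w, t''). (w, 1 + vsize v + t + t' + t'')) (run_while v')))"

end

primrec run :: "prog \<Rightarrow> val \<Rightarrow> (val \<times> nat) spmf" where
  "run (Op i) = (\<lambda>v. return_spmf (step i v, 1 + vsize v + vsize (step i v)))"
| "run Flip = (\<lambda>v. map_spmf (\<lambda>b. (Num (if b then 1 else 0), 2 + vsize v)) coin_spmf)"
| "run (Seq p q) = (\<lambda>v.
     bind_spmf (run p v) (\<lambda>(w, t).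
       map_spmf (\<lambda>(u, t'). (u, 1 + t + t')) (run q w)))"
| "run (Fork p q) = (\<lambda>v.
     bind_spmf (run p v) (\<lambda>(a, t).
       map_spmf (\<lambda>(b, t'). (VPair a b, 1 + vsize v + t + t')) (run q v)))"
| "run (Cond c p q) = (\<lambda>v.
     bind_spmf (run c v) (\<lambda>(b, t).
       map_spmf (\<lambda>(w, t'). (w, 1 + vsize v + t + t'))
         (if b = Num 0 then run q v else run p v)))"
| "run (While c p) = run_while (run c) (run p)"

definition computes :: "prog \<Rightarrow> val \<Rightarrow> val \<Rightarrow> nat \<Rightarrow> bool" where
  "computes p v r t \<longleftrightarrow> flip_free p \<and> run p v = return_spmf (r, t)"

text \<open>In particular \<open>p\<close> terminates with probability 1.\<close>

definition has_output_distribution :: "prog \<Rightarrow> val \<Rightarrow> val pmf \<Rightarrow> bool" where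
  "has_output_distribution p v D \<longleftrightarrow> map_spmf fst (run p v) = spmf_of_pmf D"

definition expected_time :: "prog \<Rightarrow> val \<Rightarrow> ennreal" where
  "expected_time p v =
     (if lossless_spmf (run p v)
      then \<integral>\<^sup>+ x. of_nat (snd x) \<partial>measure_spmf (run p v) else \<infinity>)"

text \<open>
  The task is to compute, for every \<open>x\<close> in \<open>D\<close>, some result that is good for \<open>x\<close>. Polynomials with
  natural number coefficients suffice as time bounds.
\<close>

definition poly_time_task :: "('a \<Rightarrow> val) \<Rightarrow> 'a set \<Rightarrow> ('a \<Rightarrow> val \<Rightarrow> bool) \<Rightarrow> bool" where
  "poly_time_task enc D good \<longleftrightarrow>
     (\<exists>(p :: prog) (q :: nat poly). \<forall>x\<in>D. \<exists>r t.
        computes p (enc x) r t \<and> good x r \<and> t \<le> poly q (vsize (enc x)))"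


section \<open>Encodings\<close>

primrec enc_list :: "val list \<Rightarrow> val" where
  "enc_list [] = Num 0"
| "enc_list (x # xs) = VPair x (enc_list xs)"

definition unary :: "nat \<Rightarrow> val" where
  "unary n = enc_list (replicate n (Num 0))"

text \<open>Used for nonnegative numbers only.\<close>

definition enc_rat :: "rat \<Rightarrow> val" where
  "enc_rat x = VPair (Num (nat (fst (quotient_of x)))) (Num (nat (snd (quotient_of x))))"

text \<open>Words are lists over an alphabet that is a finite set of natural numbers.\<close>

type_synonym word = "nat list"

definition enc_word :: "word \<Rightarrow> val" where
  "enc_word w = enc_list (map Num w)"

primrec instr_code :: "instr \<Rightarrow> val" where
  "instr_code Ident = VPair (Num 0) (Num 0)"
| "instr_code (Const c) = VPair (Num 1) c"
| "instr_code Fst = VPair (Num 2) (Num 0)"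
| "instr_code Snd = VPair (Num 3) (Num 0)"
| "instr_code IsPair = VPair (Num 4) (Num 0)"
| "instr_code Add = VPair (Num 5) (Num 0)"
| "instr_code Sub = VPair (Num 6) (Num 0)"
| "instr_code Mul = VPair (Num 7) (Num 0)"
| "instr_code Div = VPair (Num 8) (Num 0)"
| "instr_code Less = VPair (Num 9) (Num 0)"

text \<open>An algorithm whose result is again an algorithm outputs the text of a program.\<close>

primrec prog_code :: "prog \<Rightarrow> val" where
  "prog_code (Op i) = VPair (Num 0) (instr_code i)"
| "prog_code Flip = VPair (Num 1) (Num 0)"
| "prog_code (Seq p q) = VPair (Num 2) (VPair (prog_code p) (prog_code q))"
| "prog_code (Fork p q) = VPair (Num 3) (VPair (prog_code p) (prog_code q))"
| "prog_code (Cond c p q) =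
     VPair (Num 4) (VPair (prog_code c) (VPair (prog_code p) (prog_code q)))"
| "prog_code (While c p) = VPair (Num 5) (VPair (prog_code c) (prog_code p))"

definition bottom :: val where
  "bottom = Num 0"

lemma instr_code_inject: "instr_code i = instr_code j \<longleftrightarrow> i = j"
  by (cases i; cases j) simp_all

lemma prog_code_inject: "prog_code p = prog_code q \<longleftrightarrow> p = q"
proof (induction p arbitrary: q)
  case (Op i)
  then show ?case by (cases q) (simp_all add: instr_code_inject)
next
  case Flip
  then show ?case by (cases q) simp_all
next
  case (Seq p1 p2)
  then show ?case by (cases q) simp_all
next
  case (Fork p1 p2)
  then show ?case by (cases q) simp_all
next
  case (Cond p1 p2 p3)
  then show ?case by (cases q) simp_all
next
  case (While p1 p2)
  then show ?case by (cases q) simp_all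
qed

lemma prog_code_neq_bottom: "prog_code p \<noteq> bottom"
  by (cases p) (simp_all add: bottom_def)


section \<open>Classes of specifications and their operations\<close>

text \<open>\<open>repr\<close> is the finite representation, from which algorithms work.\<close>

record spec =
  repr :: val
  alphabet :: "nat set"
  lang :: "word set"

definition spec_class :: "spec set \<Rightarrow> bool" where
  "spec_class Spec \<longleftrightarrow>
     inj_on repr Spec \<and>
     (\<forall>X\<in>Spec. finite (alphabet X) \<and> lang X \<subseteq> lists (alphabet X))"

definition poly_time_intersection :: "spec set \<Rightarrow> bool" where
  "poly_time_intersection Spec \<longleftrightarrow>
     poly_time_task
       (\<lambda>(X, Y). VPair (repr X) (repr Y))
       {(X, Y). X \<in> Spec \<and> Y \<in> Spec \<and> alphabet X = alphabet Y}
       (\<lambda>(X, Y) r. \<exists>Z\<in>Spec. r = repr Z \<and> alphabet Z = alphabet X \<and>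
          lang Z = lang X \<inter> lang Y)"

definition poly_time_difference :: "spec set \<Rightarrow> bool" where
  "poly_time_difference Spec \<longleftrightarrow>
     poly_time_task
       (\<lambda>(X, Y). VPair (repr X) (repr Y))
       {(X, Y). X \<in> Spec \<and> Y \<in> Spec \<and> alphabet X = alphabet Y}
       (\<lambda>(X, Y) r. \<exists>Z\<in>Spec. r = repr Z \<and> alphabet Z = alphabet X \<and>
          lang Z = lang X - lang Y)"

definition poly_time_length_restriction :: "spec set \<Rightarrow> bool" where
  "poly_time_length_restriction Spec \<longleftrightarrow>
     poly_time_task
       (\<lambda>(X, m, n). VPair (repr X) (VPair (unary m) (unary n)))
       {(X, m, n). X \<in> Spec}
       (\<lambda>(X, m, n) r. \<exists>Y\<in>Spec. r = repr Y \<and> alphabet Y = alphabet X \<and>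
          lang Y = {w \<in> lang X. m \<le> length w \<and> length w \<le> n})"

definition length_bound :: "spec \<Rightarrow> nat \<Rightarrow> bool" where
  "length_bound X n \<longleftrightarrow> (\<forall>w\<in>lang X. length w \<le> n)"

definition poly_time_counting :: "spec set \<Rightarrow> bool" where
  "poly_time_counting Spec \<longleftrightarrow>
     poly_time_task
       (\<lambda>(X, n). VPair (repr X) (unary n))
       {(X, n). X \<in> Spec \<and> length_bound X n}
       (\<lambda>(X, n) r. r = Num (card (lang X)))"

definition poly_time_uniform_sampling :: "spec set \<Rightarrow> bool" where
  "poly_time_uniform_sampling Spec \<longleftrightarrow>
     (\<exists>(p :: prog) (q :: nat poly). \<forall>X\<in>Spec. \<forall>n. length_bound X n \<and> lang X \<noteq> {} \<longrightarrow>
        (let v = VPair (repr X) (unary n) in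
           has_output_distribution p v (map_pmf enc_word (pmf_of_set (lang X))) \<and>
           expected_time p v \<le> of_nat (poly q (vsize v))))"


section \<open>Control improvisation\<close>

record ci_instance =
  hard :: spec
  soft :: spec
  min_len :: nat
  max_len :: nat
  eps :: rat
  lam :: rat
  rho :: rat

definition CI :: "spec set \<Rightarrow> spec set \<Rightarrow> ci_instance set" where
  "CI A B =
     {C. hard C \<in> A \<and> soft C \<in> B \<and> alphabet (hard C) = alphabet (soft C) \<and>
         eps C \<in> {0..1} \<and> lam C \<in> {0..1} \<and> rho C \<in> {0..1}}"

definition inst_code :: "ci_instance \<Rightarrow> val" where
  "inst_code C =
     enc_list [repr (hard C), repr (soft C), unary (min_len C), unary (max_len C),
       enc_rat (eps C), enc_rat (lam C), enc_rat (rho C)]"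

definition inst_size :: "ci_instance \<Rightarrow> nat" where
  "inst_size C = vsize (inst_code C)"

definition I_set :: "ci_instance \<Rightarrow> word set" where
  "I_set C = {w \<in> lang (hard C). min_len C \<le> length w \<and> length w \<le> max_len C}"

definition A_set :: "ci_instance \<Rightarrow> word set" where
  "A_set C = I_set C \<inter> lang (soft C)"

definition improvising_distribution :: "ci_instance \<Rightarrow> word pmf \<Rightarrow> bool" where
  "improvising_distribution C D \<longleftrightarrow>
     set_pmf D \<subseteq> lists (alphabet (hard C)) \<and>
     measure_pmf.prob D (I_set C) = 1 \<and>
     measure_pmf.prob D (A_set C) \<ge> 1 - of_rat (eps C) \<and>
     (\<forall>w\<in>I_set C. of_rat (lam C) \<le> pmf D w \<and> pmf D w \<le> of_rat (rho C))"

definition feasible :: "ci_instance \<Rightarrow> bool" where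
  "feasible C \<longleftrightarrow> (\<exists>D. improvising_distribution C D)"

text \<open>Programs are run on the empty input by passing \<^term>\<open>Num 0\<close>.\<close>

definition improviser :: "ci_instance \<Rightarrow> prog \<Rightarrow> bool" where
  "improviser C G \<longleftrightarrow>
     expected_time G (Num 0) < \<infinity> \<and>
     (\<exists>D. improvising_distribution C D \<and>
        has_output_distribution G (Num 0) (map_pmf enc_word D))"

definition scheme_correct :: "ci_instance set \<Rightarrow> prog \<Rightarrow> bool" where
  "scheme_correct P S \<longleftrightarrow>
     (\<forall>C\<in>P.
        (feasible C \<longrightarrow>
           (\<exists>G t. computes S (inst_code C) (prog_code G) t \<and> improviser C G)) \<and>
        (\<not> feasible C \<longrightarrow> (\<exists>t. computes S (inst_code C) bottom t)))"

definition scheme_efficient :: "ci_instance set \<Rightarrow> prog \<Rightarrow> bool" where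
  "scheme_efficient P S \<longleftrightarrow>
     (\<exists>p :: nat poly. \<forall>C\<in>P. \<exists>r t.
        computes S (inst_code C) r t \<and> t \<le> poly p (inst_size C))"

definition improvisers_efficient :: "ci_instance set \<Rightarrow> prog \<Rightarrow> bool" where
  "improvisers_efficient P S \<longleftrightarrow>
     (\<exists>q :: nat poly. \<forall>C\<in>P. \<forall>G t.
        computes S (inst_code C) (prog_code G) t \<longrightarrow>
        expected_time G (Num 0) \<le> of_nat (poly q (inst_size C)))"

definition poly_time_improvisation_scheme :: "ci_instance set \<Rightarrow> prog \<Rightarrow> bool" where
  "poly_time_improvisation_scheme P S \<longleftrightarrow>
     scheme_correct P S \<and> scheme_efficient P S \<and> improvisers_efficient P S"

end

theory Submission
  imports Defs
begin

text \<open>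
  Let \<open>B = I - A\<close>. Averaging shows that an improvising distribution exists iff
  \<open>\<lambda> |I| \<le> 1 \<le> \<rho> |I|\<close> and \<open>1 - \<epsilon> \<le> p\<close>, where \<open>p = min (\<rho> |A|) (1 - \<lambda> |B|)\<close>: then the mixture of the
  uniform distributions on \<open>A\<close> and \<open>B\<close> with weights \<open>p\<close> and \<open>1 - p\<close> is one. Specifications of \<open>A\<close> and
  \<open>B\<close>, their sizes and the fraction \<open>p\<close> are computed without loops from the given operations. The
  improviser is a fixed program with these data inserted as a constant: it tosses a coin with the
  rational bias \<open>p\<close> by comparing fair coin flips with the binary expansion of \<open>p\<close>, where each round is
  the last one with probability \<open>1 / 2\<close>, and then samples from \<open>A\<close> or \<open>B\<close>.
\<close>

section \<open>Functions computable in polynomial time\<close>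

text \<open>Operations, flips and loop exits are charged at least the size of what they return, and
  the other constructs inherit this from their parts. Hence a time bound is also a bound on the size
  of the result, which is what lets polynomial bounds compose.\<close>

lemma vsize_le_time: "(w, t) \<in> set_spmf (run p v) \<Longrightarrow> vsize w \<le> t"
proof (induction p arbitrary: v w t)
  case (While c p)
  \<comment> \<open>Every iteration takes time, so that the number of iterations is covered by induction on \<open>t\<close>.\<close>
  have "(w, t) \<in> set_spmf (run_while (run c) (run p) v) \<Longrightarrow> vsize w \<le> t" for v
  proof (induction t arbitrary: v w rule: less_induct)
    case (less t)
    then have "(w, t) \<in> set_spmf (run c v \<bind> (\<lambda>(b, t).
       if b = Num 0 then return_spmf (v, 1 + vsize v + t)
       else bind_spmf (run p v) (\<lambda>(v', t').
         map_spmf (\<lambda>(w, t''). (w, 1 + vsize v + t + t' + t'')) (run_while (run c) (run p) v'))))"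
      by (subst (asm) run_while.simps)
    then consider "vsize w \<le> t"
      | v' t'' where "(w, t'') \<in> set_spmf (run_while (run c) (run p) v')" "t'' < t"
      by (fastforce simp: set_bind_spmf split: if_splits)
    then show ?case
      using less.IH by cases fastforce+
  qed
  then show ?case using While.prems by simp
next
  case Flip
  then show ?case by (auto simp: floorlog_def)
next
  case (Seq p q)
  then show ?case by (fastforce simp: set_bind_spmf)
next
  case (Fork p q)
  then obtain a s b s' where "(a, s) \<in> set_spmf (run p v)" "(b, s') \<in> set_spmf (run q v)"
      "w = VPair a b" "t = 1 + vsize v + s + s'"
    by (auto simp: set_bind_spmf)
  then show ?case using Fork.IH(1)[of a s v] Fork.IH(2)[of b s' v] by simp
next
  case (Cond c p q)
  then show ?case by (fastforce simp: set_bind_spmf split: if_splits)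
qed simp

lemma computes_fun: "computes p v r t \<Longrightarrow> computes p v r' t' \<Longrightarrow> r = r' \<and> t = t'"
  by (simp add: computes_def)

lemma computes_vsize_le: "computes p v r t \<Longrightarrow> vsize r \<le> t"
  using vsize_le_time[of r t p v] by (simp add: computes_def)

lemma poly_nat_mono: "x \<le> y \<Longrightarrow> poly q x \<le> poly q y" for x y :: nat and q :: "nat poly"
  by (induction q) (auto intro: add_mono mult_mono)

section \<open>Closure properties of functions computable in polynomial time\<close>

definition poly_time_fun :: "('a \<Rightarrow> val) \<Rightarrow> 'a set \<Rightarrow> ('a \<Rightarrow> val) \<Rightarrow> bool" where
  "poly_time_fun enc D f \<longleftrightarrow> poly_time_task enc D (\<lambda>x r. r = f x)"

lemma poly_time_fun_iff:
  "poly_time_fun enc D f \<longleftrightarrow>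
    (\<exists>p q. \<forall>x\<in>D. \<exists>t. computes p (enc x) (f x) t \<and> t \<le> poly q (vsize (enc x)))"
  unfolding poly_time_fun_def poly_time_task_def by (metis (no_types, lifting))

lemma poly_time_funE:
  assumes "poly_time_fun enc D f"
  obtains p q where "\<And>x. x \<in> D \<Longrightarrow> \<exists>t. computes p (enc x) (f x) t \<and> t \<le> poly q (vsize (enc x))"
  using assms unfolding poly_time_fun_iff by blast

lemma poly_time_funI:
  fixes q :: "nat poly"
  assumes "\<And>x. x \<in> D \<Longrightarrow> \<exists>t. computes p (enc x) (f x) t \<and> t \<le> poly q (vsize (enc x))"
  shows "poly_time_fun enc D f"
  using assms unfolding poly_time_fun_iff by blast

lemma poly_time_fun_cong:
  assumes "poly_time_fun enc D f" "\<And>x. x \<in> D \<Longrightarrow> f x = g x"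
  shows "poly_time_fun enc D g"
  using assms unfolding poly_time_fun_iff by (metis (no_types, lifting))

lemma poly_time_fun_vsize:
  assumes "poly_time_fun enc D f"
  obtains q :: "nat poly" where "\<And>x. x \<in> D \<Longrightarrow> vsize (f x) \<le> poly q (vsize (enc x))"
  using assms unfolding poly_time_fun_iff by (meson computes_vsize_le le_trans)

text \<open>A task only constrains its result; choosing for every \<open>x\<close> the result that
  the program actually produces turns it into a function \<open>g\<close>, to which further programs
  can be applied. The map \<open>h\<close> names the object whose encoding is
  \<open>f x\<close>.\<close>

lemma poly_time_task_comp:
  assumes f: "poly_time_fun enc D f" and task: "poly_time_task enc' D' good"
    and h: "\<And>x. x \<in> D \<Longrightarrow> h x \<in> D' \<and> f x = enc' (h x)"
  obtains g where "poly_time_fun enc D g" "\<And>x. x \<in> D \<Longrightarrow> good (h x) (g x)"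
proof -
  obtain p q where p: "\<And>x. x \<in> D \<Longrightarrow> \<exists>t. computes p (enc x) (f x) t \<and> t \<le> poly q (vsize (enc x))"
    using poly_time_funE[OF f] by blast
  obtain p' q' where p': "\<And>y. y \<in> D' \<Longrightarrow>
      \<exists>r t. computes p' (enc' y) r t \<and> good y r \<and> t \<le> poly q' (vsize (enc' y))"
    using task unfolding poly_time_task_def by blast
  have "\<exists>g. \<forall>x\<in>D. good (h x) (g x) \<and>
      (\<exists>t. computes p' (f x) (g x) t \<and> t \<le> poly q' (vsize (f x)))"
    by (rule bchoice) (metis h p')
  then obtain g where g: "\<And>x. x \<in> D \<Longrightarrow> good (h x) (g x)"
      "\<And>x. x \<in> D \<Longrightarrow> \<exists>t. computes p' (f x) (g x) t \<and> t \<le> poly q' (vsize (f x))"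
    by blast
  have "poly_time_fun enc D g"
  proof (rule poly_time_funI)
    fix x assume x: "x \<in> D"
    obtain t where t: "computes p (enc x) (f x) t" "t \<le> poly q (vsize (enc x))"
      using p[OF x] by blast
    obtain t' where t': "computes p' (f x) (g x) t'" "t' \<le> poly q' (vsize (f x))"
      using g(2)[OF x] by blast
    \<comment> \<open>The second program is bounded in terms of \<open>f x\<close>, whose size is at
      most the time \<open>t\<close> of the first program; monotonicity of \<open>q'\<close> then
      gives the composed polynomial.\<close>
    have "t' \<le> poly (pcompose q' q) (vsize (enc x))"
      using t' poly_nat_mono[of "vsize (f x)" "poly q (vsize (enc x))" q']
        computes_vsize_le[OF t(1)] t(2) by (simp add: poly_pcompose)
    moreover have "computes (Seq p p') (enc x) (g x) (1 + t + t')"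
      using t t' by (simp add: computes_def)
    ultimately show "\<exists>t. computes (Seq p p') (enc x) (g x) t \<and>
        t \<le> poly (1 + q + pcompose q' q) (vsize (enc x))"
      using t(2) by fastforce
  qed
  then show ?thesis using that g(1) by blast
qed

lemma poly_time_fun_comp:
  assumes "poly_time_fun enc D f" "poly_time_fun enc' D' g"
    and "\<And>x. x \<in> D \<Longrightarrow> h x \<in> D' \<and> f x = enc' (h x)"
  shows "poly_time_fun enc D (\<lambda>x. g (h x))"
  using poly_time_task_comp[OF assms(1) assms(2)[unfolded poly_time_fun_def] assms(3)]
  by (metis (no_types, lifting) poly_time_fun_cong)

lemma poly_time_fun_self: "poly_time_fun enc D enc"
  by (rule poly_time_funI[where p = "Op Ident" and q = "[:1, 2:]"]) (simp add: computes_def)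

lemma poly_time_fun_const: "poly_time_fun enc D (\<lambda>_. c)"
  by (rule poly_time_funI[where p = "Op (Const c)" and q = "[:1 + vsize c, 1:]"])
    (simp add: computes_def)

section \<open>Bit lengths of the results of instructions\<close>

lemma less_power_floorlog: "a < 2 ^ floorlog 2 a"
  by (cases "a = 0") (use floorlog_bounds[of a 2] in \<open>auto simp: floorlog_def\<close>)

lemma floorlog_le_of_less_power: "a < 2 ^ k \<Longrightarrow> floorlog 2 a \<le> k"
  by (simp add: floorlog_le_iff)

lemma floorlog_add_le: "floorlog 2 (a + b) \<le> 1 + floorlog 2 a + floorlog 2 b"
proof (rule floorlog_le_of_less_power)
  let ?k = "floorlog 2 a + floorlog 2 b"
  have "(2::nat) ^ floorlog 2 a \<le> 2 ^ ?k" "(2::nat) ^ floorlog 2 b \<le> 2 ^ ?k"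
    by (simp_all add: power_increasing)
  then have "a + b < 2 * 2 ^ ?k"
    using less_power_floorlog[of a] less_power_floorlog[of b] by linarith
  then show "a + b < 2 ^ (1 + floorlog 2 a + floorlog 2 b)" by simp
qed

lemma floorlog_mult_le: "floorlog 2 (a * b) \<le> floorlog 2 a + floorlog 2 b"
proof (cases "a = 0 \<or> b = 0")
  case False
  then show ?thesis
    using mult_strict_mono'[OF less_power_floorlog[of a] less_power_floorlog[of b]]
    by (intro floorlog_le_of_less_power) (simp add: power_add)
qed (auto simp: floorlog_def)

text \<open>A product has at most as many bits as its factors together, and the other arithmetic
  results are no longer than that up to a constant. The summand
  \<open>vsize (step i (Num 0))\<close> accounts for the value that \<open>Const\<close>
  returns.\<close>

lemma vsize_step_le: "vsize (step i v) \<le> vsize v + vsize (step i (Num 0)) + 2"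
proof (cases "(i, v)" rule: step.cases)
  case (6 a b)
  then show ?thesis using floorlog_add_le[of a b] by simp
next
  case (7 a b)
  then show ?thesis using floorlog_mono[of "a - b" a 2] by simp
next
  case (8 a b)
  then show ?thesis using floorlog_mult_le[of a b] by simp
next
  case (9 a b)
  then show ?thesis using floorlog_mono[of "a div b" a 2] by simp
next
  case (10 a b)
  then show ?thesis using floorlog_mono[of 1 a 2] by (simp add: floorlog_def)
qed (auto simp: floorlog_def)

lemma poly_time_fun_step:
  assumes "poly_time_fun enc D f"
  shows "poly_time_fun enc D (\<lambda>x. step i (f x))"
proof -
  have "poly_time_fun (\<lambda>v. v) UNIV (step i)"
    by (rule poly_time_funI[where p = "Op i" and q = "[:3 + vsize (step i (Num 0)), 2:]"])
      (use vsize_step_le[of i] in \<open>auto simp: computes_def algebra_simps\<close>)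
  from poly_time_fun_comp[OF assms this, of f] show ?thesis by simp
qed

lemma poly_time_fun_VPair:
  assumes "poly_time_fun enc D f" "poly_time_fun enc D g"
  shows "poly_time_fun enc D (\<lambda>x. VPair (f x) (g x))"
proof -
  obtain p q where p: "\<And>x. x \<in> D \<Longrightarrow> \<exists>t. computes p (enc x) (f x) t \<and> t \<le> poly q (vsize (enc x))"
    using poly_time_funE[OF assms(1)] by blast
  obtain p' q' where p': "\<And>x. x \<in> D \<Longrightarrow>
      \<exists>t. computes p' (enc x) (g x) t \<and> t \<le> poly q' (vsize (enc x))"
    using poly_time_funE[OF assms(2)] by blast
  show ?thesis
    by (rule poly_time_funI[where p = "Fork p p'" and q = "[:1, 1:] + q + q'"])
      (use p p' in \<open>fastforce simp: computes_def\<close>)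
qed

lemma poly_time_fun_If:
  assumes "poly_time_fun enc D (\<lambda>x. Num (of_bool (P x)))"
    and "poly_time_fun enc D f" "poly_time_fun enc D g"
  shows "poly_time_fun enc D (\<lambda>x. if P x then f x else g x)"
proof -
  obtain c r where c: "\<And>x. x \<in> D \<Longrightarrow>
      \<exists>t. computes c (enc x) (Num (of_bool (P x))) t \<and> t \<le> poly r (vsize (enc x))"
    using poly_time_funE[OF assms(1)] by blast
  obtain p q where p: "\<And>x. x \<in> D \<Longrightarrow> \<exists>t. computes p (enc x) (f x) t \<and> t \<le> poly q (vsize (enc x))"
    using poly_time_funE[OF assms(2)] by blast
  obtain p' q' where p': "\<And>x. x \<in> D \<Longrightarrow>
      \<exists>t. computes p' (enc x) (g x) t \<and> t \<le> poly q' (vsize (enc x))"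
    using poly_time_funE[OF assms(3)] by blast
  show ?thesis
  proof (rule poly_time_funI[where p = "Cond c p p'" and q = "[:1, 1:] + r + q + q'"])
    fix x assume "x \<in> D"
    then show "\<exists>t. computes (Cond c p p') (enc x) (if P x then f x else g x) t \<and>
        t \<le> poly ([:1, 1:] + r + q + q') (vsize (enc x))"
      using c[of x] p[of x] p'[of x] by (cases "P x") (fastforce simp: computes_def)+
  qed
qed

lemma poly_time_fun_fst:
  assumes "poly_time_fun enc D (\<lambda>x. VPair (f x) (g x))"
  shows "poly_time_fun enc D f"
  using poly_time_fun_step[OF assms, of Fst] by simp

lemma poly_time_fun_snd:
  assumes "poly_time_fun enc D (\<lambda>x. VPair (f x) (g x))"
  shows "poly_time_fun enc D g"
  using poly_time_fun_step[OF assms, of Snd] by simp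

lemma poly_time_fun_arith:
  assumes "poly_time_fun enc D (\<lambda>x. Num (a x))" "poly_time_fun enc D (\<lambda>x. Num (b x))"
  shows poly_time_fun_add: "poly_time_fun enc D (\<lambda>x. Num (a x + b x))"
    and poly_time_fun_diff: "poly_time_fun enc D (\<lambda>x. Num (a x - b x))"
    and poly_time_fun_mult: "poly_time_fun enc D (\<lambda>x. Num (a x * b x))"
    and poly_time_fun_less: "poly_time_fun enc D (\<lambda>x. Num (of_bool (a x < b x)))"
  using poly_time_fun_step[OF poly_time_fun_VPair[OF assms], of Add]
    poly_time_fun_step[OF poly_time_fun_VPair[OF assms], of Sub]
    poly_time_fun_step[OF poly_time_fun_VPair[OF assms], of Mul]
    poly_time_fun_step[OF poly_time_fun_VPair[OF assms], of Less]
  by (simp_all add: of_bool_def)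

section \<open>Coins with rational bias\<close>

lemma nn_integral_bind_spmf:
  "(\<integral>\<^sup>+ x. f x \<partial>measure_spmf (bind_spmf p g)) =
    (\<integral>\<^sup>+ y. \<integral>\<^sup>+ x. f x \<partial>measure_spmf (g y) \<partial>measure_spmf p)"
  unfolding measure_spmf_bind o_def
  by (rule nn_integral_bind[where B = "count_space UNIV"])
    (auto simp: measurable_def space_subprob_algebra)

lemma nn_integral_return_spmf: "(\<integral>\<^sup>+ x. f x \<partial>measure_spmf (return_spmf a)) = f a"
  by (simp flip: spmf_of_pmf_return_pmf)

lemma nn_integral_map_spmf:
  "(\<integral>\<^sup>+ x. f x \<partial>measure_spmf (map_spmf h p)) = (\<integral>\<^sup>+ x. f (h x) \<partial>measure_spmf p)"
  by (simp add: map_spmf_conv_bind_spmf nn_integral_bind_spmf nn_integral_return_spmf)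

lemma nn_integral_const_spmf_le: "(\<integral>\<^sup>+ x. c \<partial>measure_spmf p) \<le> c"
  using mult_left_mono[OF measure_spmf.emeasure_space_le_1[of p], of c] by simp

lemma coin_spmf_eq_bernoulli: "coin_spmf = spmf_of_pmf (bernoulli_pmf (1 / 2))"
  by (simp add: bernoulli_pmf_half_conv_pmf_of_set)

lemma nn_integral_coin_spmf:
  "(\<integral>\<^sup>+ c. f c \<partial>measure_spmf coin_spmf) = ennreal (1 / 2) * (f True + f False)"
  by (simp add: coin_spmf_eq_bernoulli distrib_left mult.commute del: spmf_of_pmf_pmf_of_set)

lemma spmf_bind_coin_spmf:
  "spmf (coin_spmf \<bind> g) v = (spmf (g True) v + spmf (g False) v) / 2"
  by (simp add: coin_spmf_eq_bernoulli pmf_bind del: spmf_of_pmf_pmf_of_set)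

text \<open>Iterating along \<open>g\<close> gives \<open>e x \<le> B / 2 ^ k\<close> for every
  \<open>k\<close>; the uniform bound \<open>B\<close> is essential for the limit. It serves both
  for the error of an output probability and for the excess of a truncated expected time.\<close>

lemma nonpos_of_halving:
  fixes e :: "'a \<Rightarrow> real"
  assumes "\<And>x. x \<in> X \<Longrightarrow> g x \<in> X \<and> e x \<le> e (g x) / 2"
    and "\<And>x. x \<in> X \<Longrightarrow> e x \<le> B" and "x \<in> X"
  shows "e x \<le> 0"
proof -
  have bound: "e x \<le> B * (1 / 2) ^ k" if "x \<in> X" for x k
    using that
  proof (induction k arbitrary: x)
    case (Suc k)
    then have "e x \<le> e (g x) / 2" "e (g x) \<le> B * (1 / 2) ^ k" using assms(1)[of x] by auto
    then show ?case by simp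
  qed (use assms(2) in auto)
  have "(\<lambda>k. B * (1 / 2) ^ k) \<longlonglongrightarrow> B * 0"
    by (intro tendsto_intros LIMSEQ_power_zero) auto
  then show ?thesis
    using bound[OF \<open>x \<in> X\<close>] by (intro Lim_bounded2[where N = 0]) auto
qed

text \<open>Repeatedly doubling \<open>x\<close> modulo \<open>b\<close> yields the binary digits of \<open>x / b\<close>. They are compared with
  fair coin flips, which are the digits of a uniformly distributed number; the first difference
  decides whether that number is below \<open>x / b\<close>.\<close>

lemma bernoulli_loop:
  fixes L :: "nat \<Rightarrow> (val \<times> nat) spmf" and b :: nat
  defines "digit \<equiv> \<lambda>x. b \<le> 2 * x"
  defines "doubled \<equiv> \<lambda>x. if digit x then 2 * x - b else 2 * x"
  assumes b: "0 < b"
    and L: "\<And>x. x \<le> b \<Longrightarrow> L x = coin_spmf \<bind> (\<lambda>c. if c = digit x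
        then map_spmf (\<lambda>(w, t). (w, s c x + t)) (L (doubled x))
        else return_spmf (Num (of_bool (digit x)), s c x))"
    and s: "\<And>c x. x \<le> b \<Longrightarrow> s c x \<le> K"
    and x: "x \<le> b"
  shows "map_spmf fst (L x) = spmf_of_pmf (map_pmf (\<lambda>h. Num (of_bool h)) (bernoulli_pmf (x / b)))"
    and "(\<integral>\<^sup>+ y. of_nat (snd y) \<partial>measure_spmf (L x)) \<le> of_nat (2 * K)"
proof -
  \<comment> \<open>The endpoint \<open>x = b\<close> is a fixed point all of whose digits are 1, so
    that bias 1 is covered by the expansion 0.111... without a special case.\<close>
  have doubled: "doubled x \<le> b" if "x \<le> b" for x
    using that by (auto simp: doubled_def digit_def)
  have fst_map: "map_spmf fst (map_spmf (\<lambda>(w, t). (w, k + t)) p) = map_spmf fst p"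
    for k :: nat and p :: "(val \<times> nat) spmf"
    by (simp add: spmf.map_comp o_def case_prod_unfold)
  define target where "target x = spmf_of_pmf (map_pmf (\<lambda>h. Num (of_bool h)) (bernoulli_pmf (x / b)))"
    for x :: nat
  have target: "spmf (target x) v = x / b * of_bool (v = Num 1) + (1 - x / b) * of_bool (v = Num 0)"
    if "x \<le> b" for x v
  proof -
    have "0 \<le> x / b" "x / b \<le> 1" using that b by auto
    then show ?thesis
      by (auto simp: target_def map_pmf_def pmf_bind indicator_def)
  qed
  have halves: "\<bar>(u + c) / 2 - (t + c) / 2\<bar> = \<bar>u - t\<bar> / 2" for u t c :: real
    by (simp flip: diff_divide_distrib)
  show "map_spmf fst (L x) = target x"
  proof (rule spmf_eqI)
    fix v
    \<comment> \<open>Both probabilities satisfy the same recurrence, in which the value at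
      \<open>doubled x\<close> has weight one half. The inhomogeneous terms cancel in the
      difference, so the error halves.\<close>
    let ?e = "\<lambda>x. \<bar>spmf (map_spmf fst (L x)) v - spmf (target x) v\<bar>"
    have "?e x \<le> 0"
    proof (rule nonpos_of_halving[where X = "{..b}" and g = doubled and B = 1 and e = ?e])
      fix x assume "x \<in> {..b}"
      then have x: "x \<le> b" by simp
      have "map_spmf fst (L x) = coin_spmf \<bind> (\<lambda>c. if c = digit x
        then map_spmf fst (L (doubled x)) else return_spmf (Num (of_bool (digit x))))"
        by (subst L[OF x]) (auto simp: map_spmf_bind_spmf o_def fst_map intro!: bind_spmf_cong)
      then have 1: "spmf (map_spmf fst (L x)) v =
          (spmf (map_spmf fst (L (doubled x))) v + of_bool (v = Num (of_bool (digit x)))) / 2"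
        by (cases "digit x") (simp_all add: spmf_bind_coin_spmf indicator_def)
      \<comment> \<open>This is the digit expansion: \<open>x / b\<close> is half the sum of the
        leading digit and \<open>doubled x / b\<close>.\<close>
      have 2: "spmf (target x) v = (spmf (target (doubled x)) v + of_bool (v = Num (of_bool (digit x)))) / 2"
        unfolding target[OF x] target[OF doubled[OF x]] using b
        by (auto simp: doubled_def digit_def field_simps of_nat_diff)
      show "doubled x \<in> {..b} \<and> ?e x \<le> ?e (doubled x) / 2"
        using doubled[OF x] unfolding 1 2 by (simp add: halves)
      next
      show "?e x \<le> 1" for x
        using pmf_nonneg[of "map_spmf fst (L x)" "Some v"] pmf_le_1[of "map_spmf fst (L x)" "Some v"]
         pmf_nonneg[of "target x" "Some v"] pmf_le_1[of "target x" "Some v"] by linarith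
    qed (use x in auto)
    then show "spmf (map_spmf fst (L x)) v = spmf (target x) v" by simp
  qed
  \<comment> \<open>The recurrence for the expected time also has the solution \<open>\<infinity>\<close>; truncating the time excludes it.\<close>
  define E where "E N x = (\<integral>\<^sup>+ y. of_nat (min N (snd y)) \<partial>measure_spmf (L x))" for N x
  have E_le: "E N x \<le> of_nat N" for N x
  proof -
    have "E N x \<le> (\<integral>\<^sup>+ y. of_nat N \<partial>measure_spmf (L x))"
      unfolding E_def by (intro nn_integral_mono of_nat_mono) auto
    also have "\<dots> \<le> of_nat N"
      by (rule nn_integral_const_spmf_le)
    finally show ?thesis .
  qed
  \<comment> \<open>A round costs at most \<open>K\<close>, also after truncation, since
    \<open>min N (s + t) \<le> K + min N t\<close> whenever \<open>s \<le> K\<close>. With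
    probability one half the loop goes on from \<open>doubled x\<close>.\<close>
  have E_rec: "E N x \<le> of_nat K + ennreal (1 / 2) * E N (doubled x)" if x: "x \<le> b" for N x
  proof -
    have map: "(\<integral>\<^sup>+ y. of_nat (min N (snd y)) \<partial>measure_spmf
        (map_spmf (\<lambda>(w, t). (w, s c x + t)) (L (doubled x)))) \<le> of_nat K + E N (doubled x)" for c
    proof -
      have "(\<integral>\<^sup>+ y. of_nat (min N (snd y)) \<partial>measure_spmf
        (map_spmf (\<lambda>(w, t). (w, s c x + t)) (L (doubled x)))) \<le>
        (\<integral>\<^sup>+ y. of_nat (K + min N (snd y)) \<partial>measure_spmf (L (doubled x)))"
        unfolding nn_integral_map_spmf using s[OF x, of c]
        by (intro nn_integral_mono of_nat_mono) (auto simp: case_prod_unfold)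
      also have "\<dots> = (\<integral>\<^sup>+ y. of_nat K \<partial>measure_spmf (L (doubled x))) + E N (doubled x)"
        unfolding E_def of_nat_add by (rule nn_integral_add) auto
      also have "\<dots> \<le> of_nat K + E N (doubled x)"
        by (intro add_right_mono nn_integral_const_spmf_le)
      finally show ?thesis .
    qed
    have "E N x = ennreal (1 / 2) * ((\<integral>\<^sup>+ y. of_nat (min N (snd y)) \<partial>measure_spmf
        (map_spmf (\<lambda>(w, t). (w, s (digit x) x + t)) (L (doubled x)))) + of_nat (min N (s (\<not> digit x) x)))"
      unfolding E_def by (subst L[OF x], cases "digit x")
        (simp_all add: nn_integral_bind_spmf nn_integral_coin_spmf nn_integral_return_spmf add.commute)
    also have "\<dots> \<le> ennreal (1 / 2) * ((of_nat K + E N (doubled x)) + of_nat K)"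
      using map s[OF x, of "\<not> digit x"] by (intro mult_left_mono add_mono of_nat_mono) auto
    also have "\<dots> = ennreal (1 / 2) * (2 * of_nat K) + ennreal (1 / 2) * E N (doubled x)"
      by (simp add: algebra_simps flip: mult_2)
    also have "ennreal (1 / 2) * (2 * of_nat K) = of_nat K"
    proof -
      have "2 * of_nat K = ennreal (2 * K)"
        by (simp add: ennreal_of_nat_eq_real_of_nat ennreal_mult)
      then show ?thesis
        using ennreal_mult[of "1 / 2" "2 * K"] by (simp add: ennreal_of_nat_eq_real_of_nat)
    qed
    finally show ?thesis .
  qed
  have E_bound: "E N x \<le> of_nat (2 * K)" for N
  proof -
    have E_real: "E N x = ennreal (enn2real (E N x))" for x
      using E_le[of N x] by (metis ennreal_enn2real_if ennreal_of_nat_eq_real_of_nat ennreal_neq_top neq_top_trans)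
    \<comment> \<open>The value \<open>2 * K\<close> solves \<open>u = K + u / 2\<close>, so the
      excess over it at most halves along the recurrence. The truncation at \<open>N\<close>
      supplies the uniform bound.\<close>
    let ?e = "\<lambda>x. enn2real (E N x) - 2 * real K"
    have "?e x \<le> 0"
    proof (rule nonpos_of_halving[where X = "{..b}" and g = doubled and B = N and e = ?e])
      fix x assume "x \<in> {..b}"
      then have x: "x \<le> b" by simp
      have "ennreal (real K + 1 / 2 * r) = of_nat K + ennreal (1 / 2) * ennreal r" if "0 \<le> r" for r
        using that ennreal_plus[of K "1 / 2 * r"] ennreal_mult[of "1 / 2" r]
        by (simp add: ennreal_of_nat_eq_real_of_nat)
      then have "ennreal (enn2real (E N x)) \<le> ennreal (real K + 1 / 2 * enn2real (E N (doubled x)))"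
        using E_rec[OF x, of N] unfolding E_real[symmetric]
        by (metis E_real enn2real_nonneg)
      then have "enn2real (E N x) \<le> real K + 1 / 2 * enn2real (E N (doubled x))"
        by (subst (asm) ennreal_le_iff) auto
      then show "doubled x \<in> {..b} \<and> ?e x \<le> ?e (doubled x) / 2"
        using doubled[OF x] by simp
    next
      fix x
      have "enn2real (E N x) \<le> real N"
        using E_le[of N x] by (intro enn2real_leI) (auto simp: ennreal_of_nat_eq_real_of_nat)
      then show "?e x \<le> real N" by simp
    qed (use x in auto)
    then show ?thesis
      using E_real[of x] by (metis diff_le_0_iff_le ennreal_leI ennreal_of_nat_eq_real_of_nat of_nat_mult of_nat_numeral)
  qed
  \<comment> \<open>The truncated times increase to the true time, and the bound is independent of
    \<open>N\<close>, so monotone convergence removes the truncation.\<close>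
  have "(\<integral>\<^sup>+ y. of_nat (snd y) \<partial>measure_spmf (L x)) = (\<integral>\<^sup>+ y. (SUP N. of_nat (min N (snd y))) \<partial>measure_spmf (L x))"
  proof (intro nn_integral_cong antisym)
    fix y :: "val \<times> nat"
    show "of_nat (snd y) \<le> (SUP N. of_nat (min N (snd y)) :: ennreal)"
      by (rule SUP_upper2[of "snd y"]) auto
    show "(SUP N. of_nat (min N (snd y)) :: ennreal) \<le> of_nat (snd y)"
      by (intro SUP_least of_nat_mono) auto
  qed
  also have "\<dots> = (SUP N. E N x)"
    unfolding E_def by (rule nn_integral_monotone_convergence_SUP)
      (auto simp: incseq_def le_fun_def intro!: of_nat_mono)
  also have "\<dots> \<le> of_nat (2 * K)"
    using E_bound by (intro SUP_least)
  finally show "(\<integral>\<^sup>+ y. of_nat (snd y) \<partial>measure_spmf (L x)) \<le> of_nat (2 * K)" .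
qed

section \<open>A program for coins with rational bias\<close>

definition mean_time :: "prog \<Rightarrow> val \<Rightarrow> ennreal" where
  "mean_time p v = (\<integral>\<^sup>+ x. of_nat (snd x) \<partial>measure_spmf (run p v))"

text \<open>An output distribution has total mass 1, which excludes the infinite case of
  \<open>expected_time\<close>. Unlike the latter, \<open>mean_time\<close> obeys the integral
  identities without a termination condition.\<close>

lemma expected_time_eq_mean_time:
  assumes "has_output_distribution p v D"
  shows "expected_time p v = mean_time p v"
proof -
  have "lossless_spmf (map_spmf fst (run p v))"
    using assms by (simp add: has_output_distribution_def)
  then show ?thesis by (simp add: expected_time_def mean_time_def)
qed

lemma run_While:
  "run (While c p) v = run c v \<bind> (\<lambda>(b, t).
     if b = Num 0 then return_spmf (v, 1 + vsize v + t)
     else run p v \<bind> (\<lambda>(v', t').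
       map_spmf (\<lambda>(w, t''). (w, 1 + vsize v + t + t' + t'')) (run (While c p) v')))"
  unfolding run.simps by (rule run_while.simps)

lemma map_fst_run_Seq:
  "map_spmf fst (run (Seq p q) v) = map_spmf fst (run p v) \<bind> (\<lambda>w. map_spmf fst (run q w))"
  by (simp add: map_spmf_bind_spmf bind_map_spmf o_def case_prod_unfold spmf.map_comp)

lemma map_fst_run_Cond:
  "map_spmf fst (run (Cond c p q) v) =
    map_spmf fst (run c v) \<bind> (\<lambda>b. map_spmf fst (run (if b = Num 0 then q else p) v))"
  by (simp add: map_spmf_bind_spmf bind_map_spmf o_def case_prod_unfold spmf.map_comp if_distrib)
   (intro bind_spmf_cong, auto simp: o_def spmf.map_comp)

text \<open>The loop state is the pair of \<open>x\<close> and \<open>b\<close>; a round that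
  decides replaces it by the outcome as a number, so \<open>IsPair\<close> is the loop test. The
  branches of the body after the flip are deterministic and free of loops.\<close>

lemma poly_time_bernoulli:
  obtains p and q :: "nat poly" where
    "\<And>a b. a \<le> b \<Longrightarrow> 0 < b \<Longrightarrow> map_spmf fst (run p (VPair (Num a) (Num b))) =
        spmf_of_pmf (map_pmf (\<lambda>h. Num (of_bool h)) (bernoulli_pmf (a / b)))"
    "\<And>a b. a \<le> b \<Longrightarrow> 0 < b \<Longrightarrow>
        mean_time p (VPair (Num a) (Num b)) \<le> of_nat (poly q (vsize (VPair (Num a) (Num b))))"
proof -
  define enc where "enc = (\<lambda>(x, b). VPair (Num x) (Num b))"
  have self: "poly_time_fun enc UNIV (\<lambda>y. VPair (Num (fst y)) (Num (snd y)))"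
    using poly_time_fun_self[of enc] by (simp add: enc_def case_prod_unfold)
  note x = poly_time_fun_fst[OF self] and b = poly_time_fun_snd[OF self]
  note xx = poly_time_fun_add[OF x x]
  note less = poly_time_fun_less[OF xx b] and const = poly_time_fun_const[of enc UNIV]
  note double = poly_time_fun_VPair[OF xx b]
    and reduce = poly_time_fun_VPair[OF poly_time_fun_diff[OF xx b] b]
  define digit where "digit b x \<longleftrightarrow> b \<le> 2 * x" for b x :: nat
  define doubled where "doubled b x = (if digit b x then 2 * x - b else 2 * x)" for b x
  define new where "new c b x =
      (if c = digit b x then VPair (Num (doubled b x)) (Num b) else Num (of_bool (digit b x)))" for c b x
  have "poly_time_fun enc UNIV (\<lambda>(x, b). new True b x)"
    by (rule poly_time_fun_cong[OF poly_time_fun_If[OF less const[of "Num 0"] reduce]])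
      (auto simp: new_def digit_def doubled_def mult_2)
  then obtain p1 q1 where p1: "\<And>y. \<exists>t. computes p1 (enc y) (case y of (x, b) \<Rightarrow> new True b x) t \<and>
      t \<le> poly q1 (vsize (enc y))"
    using poly_time_funE by (metis UNIV_I)
  have "poly_time_fun enc UNIV (\<lambda>(x, b). new False b x)"
    by (rule poly_time_fun_cong[OF poly_time_fun_If[OF less double const[of "Num 1"]]])
      (auto simp: new_def digit_def doubled_def mult_2)
  then obtain p0 q0 where p0: "\<And>y. \<exists>t. computes p0 (enc y) (case y of (x, b) \<Rightarrow> new False b x) t \<and>
      t \<le> poly q0 (vsize (enc y))"
    using poly_time_funE by (metis UNIV_I)
  define p where "p = While (Op IsPair) (Cond Flip p1 p0)"
  have T_ex: "\<exists>t. run (if c then p1 else p0) (VPair (Num x) (Num b)) = return_spmf (new c b x, t) \<and>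
      t \<le> poly (q1 + q0) (vsize (VPair (Num x) (Num b)))" for c b x
  proof -
    obtain t1 where t1: "computes p1 (enc (x, b)) (new True b x) t1" "t1 \<le> poly q1 (vsize (enc (x, b)))"
      using p1[of "(x, b)"] by auto
    obtain t0 where t0: "computes p0 (enc (x, b)) (new False b x) t0" "t0 \<le> poly q0 (vsize (enc (x, b)))"
      using p0[of "(x, b)"] by auto
    have enc: "enc (x, b) = VPair (Num x) (Num b)" by (simp add: enc_def)
    show ?thesis
    proof (cases c)
      case True
      then show ?thesis
        using t1 unfolding enc computes_def by (intro exI[of _ t1]) (simp del: vsize.simps)
    next
      case False
      then show ?thesis
        using t0 unfolding enc computes_def by (intro exI[of _ t0]) (simp del: vsize.simps)
    qed
  qed
  \<comment> \<open>The closure properties only assert that some running time exists;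
    \<open>T\<close> fixes it as a function, because the cost of a round has to be a function of the
    flip and the state.\<close>
  define T where "T c b x = (SOME t. run (if c then p1 else p0) (VPair (Num x) (Num b)) =
      return_spmf (new c b x, t) \<and> t \<le> poly (q1 + q0) (vsize (VPair (Num x) (Num b))))" for c b x
  have T: "run (if c then p1 else p0) (VPair (Num x) (Num b)) = return_spmf (new c b x, T c b x)"
    "T c b x \<le> poly (q1 + q0) (vsize (VPair (Num x) (Num b)))" for c b x
    using someI_ex[OF T_ex[of c x b]] unfolding T_def by (rule conjunct1, rule conjunct2)
  \<comment> \<open>The summands are the charge of the loop, the test \<open>IsPair\<close>, and the
    conditional with its flip and branch. A deciding round also pays for the final test, which is
    run on the outcome.\<close>
  define s where "s c b x = 1 + vsize (VPair (Num x) (Num b)) +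
      (1 + vsize (VPair (Num x) (Num b)) + vsize (Num 1)) +
      (1 + vsize (VPair (Num x) (Num b)) + (2 + vsize (VPair (Num x) (Num b))) + T c b x)
      + (if c = digit b x then 0 else 1 + 2 * vsize (Num (of_bool (digit b x))) + 1 + vsize (Num 0))" for c b x
  have body: "run (Cond Flip p1 p0) (VPair (Num x) (Num b)) = coin_spmf \<bind> (\<lambda>c. return_spmf
     (new c b x, 1 + vsize (VPair (Num x) (Num b)) + (2 + vsize (VPair (Num x) (Num b))) + T c b x))" for b x
    unfolding run.simps bind_map_spmf
    by (intro bind_spmf_cong refl)
      (use T(1)[of True x b] T(1)[of False x b] in \<open>auto split: if_splits simp del: vsize.simps\<close>)
  have exit: "run p (Num r) = return_spmf (Num r, 1 + 2 * vsize (Num r) + 1 + vsize (Num 0))" for r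
    unfolding p_def by (subst run_While) simp
  have loop: "run p (VPair (Num x) (Num b)) = coin_spmf \<bind> (\<lambda>c. if c = digit b x
      then map_spmf (\<lambda>(w, t). (w, s c b x + t)) (run p (VPair (Num (doubled b x)) (Num b)))
      else return_spmf (Num (of_bool (digit b x)), s c b x))" for b x
  proof -
    let ?v = "VPair (Num x) (Num b)"
    have "run p ?v = coin_spmf \<bind> (\<lambda>c. map_spmf (\<lambda>(w, t). (w, 1 + vsize ?v +
        (1 + vsize ?v + vsize (Num 1)) + (1 + vsize ?v + (2 + vsize ?v) + T c b x) + t)) (run p (new c b x)))"
      unfolding p_def by (subst run_While, unfold body, fold p_def) (simp del: vsize.simps)
    also have "\<dots> = coin_spmf \<bind> (\<lambda>c. if c = digit b x
      then map_spmf (\<lambda>(w, t). (w, s c b x + t)) (run p (VPair (Num (doubled b x)) (Num b)))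
      else return_spmf (Num (of_bool (digit b x)), s c b x))"
      by (intro bind_spmf_cong refl) (auto simp: exit s_def new_def simp del: vsize.simps)
    finally show ?thesis .
  qed
  \<comment> \<open>As \<open>x \<le> b\<close> holds in all reachable states, the pair of
    \<open>b\<close> with itself bounds their sizes; the constants are generous.\<close>
  define K where "K b = 20 + 5 * vsize (VPair (Num b) (Num b)) +
      poly (q1 + q0) (vsize (VPair (Num b) (Num b)))" for b
  have s_le: "s c b x \<le> K b" if "x \<le> b" for c b x
  proof -
    let ?X = "vsize (VPair (Num x) (Num b))" and ?Y = "vsize (VPair (Num b) (Num b))"
    have X: "?X \<le> ?Y" using that by (simp add: floorlog_mono)
    have "vsize (Num (of_bool h)) \<le> 2" "vsize (Num 1) = 2" "vsize (Num 0) = 1" for h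
      by (cases h; simp add: floorlog_def)+
    moreover have "T c b x \<le> poly (q1 + q0) ?Y"
      using T(2)[of c b x] poly_nat_mono[OF X, of "q1 + q0"] by (rule le_trans)
    ultimately show ?thesis
      unfolding s_def K_def using X by (auto simp del: vsize.simps poly_add intro: le_trans)
  qed
  \<comment> \<open>The factor 2 comes from the bound \<open>2 * K b\<close> on the expected time.
    The argument is doubled because \<open>VPair (Num b) (Num b)\<close> is at most twice as large
    as the input.\<close>
  define q where "q = [:2:] * ([:20, 10:] + pcompose (q1 + q0) [:0, 2:])"
  have K: "2 * K b \<le> poly q (vsize (VPair (Num a) (Num b)))" for a b
  proof -
    have Y: "vsize (VPair (Num b) (Num b)) \<le> 2 * vsize (VPair (Num a) (Num b))" by simp
    have q: "poly q V = 40 + 20 * V + 2 * poly (q1 + q0) (2 * V)" for V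
      by (simp add: q_def poly_pcompose mult.commute)
    have "2 * (20 + 5 * y + u) \<le> 40 + 20 * x + 2 * w" if "y \<le> 2 * x" "u \<le> w" for x y u w :: nat
      using that by simp
    from this[OF Y poly_nat_mono[OF Y, of "q1 + q0"]] show ?thesis
      unfolding K_def q .
  qed
  show ?thesis
  proof (rule that)
    fix a b :: nat
    assume ab: "a \<le> b" "0 < b"
    note * = bernoulli_loop[of b "\<lambda>x. run p (VPair (Num x) (Num b))" "\<lambda>c x. s c b x" "K b" a,
        folded digit_def, folded doubled_def, OF ab(2) loop s_le ab(1)]
    show "map_spmf fst (run p (VPair (Num a) (Num b))) =
        spmf_of_pmf (map_pmf (\<lambda>h. Num (of_bool h)) (bernoulli_pmf (a / b)))"
      by (rule *(1))
    show "mean_time p (VPair (Num a) (Num b)) \<le> of_nat (poly q (vsize (VPair (Num a) (Num b))))"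
      unfolding mean_time_def using *(2) K[of b a] by (meson of_nat_mono order_trans)
  qed
qed

section \<open>Feasible instances\<close>

definition B_set :: "ci_instance \<Rightarrow> word set" where
  "B_set C = I_set C - lang (soft C)"

lemma I_set_eq: "I_set C = A_set C \<union> B_set C" and A_B_disjoint: "A_set C \<inter> B_set C = {}"
  by (auto simp: A_set_def B_set_def)

text \<open>The largest probability that an improvising distribution can give to \<^term>\<open>A_set C\<close>.\<close>

definition max_soft_prob :: "ci_instance \<Rightarrow> real" where
  "max_soft_prob C =
    min (of_rat (rho C) * card (A_set C)) (1 - of_rat (lam C) * card (B_set C))"

text \<open>The size of \<open>I_set C\<close> is written as the sum of the two cardinalities that
  the counting operation delivers.\<close>

definition feasibility_condition :: "ci_instance \<Rightarrow> bool" where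
  "feasibility_condition C \<longleftrightarrow>
    of_rat (lam C) * real (card (A_set C) + card (B_set C)) \<le> 1 \<and>
    1 \<le> of_rat (rho C) * real (card (A_set C) + card (B_set C)) \<and>
    1 - of_rat (eps C) \<le> max_soft_prob C"

definition soft_mixture :: "ci_instance \<Rightarrow> word pmf" where
  "soft_mixture C = bernoulli_pmf (max_soft_prob C) \<bind>
    (\<lambda>h. pmf_of_set (if h then A_set C else B_set C))"

context
  fixes C :: ci_instance
  assumes fin: "finite (I_set C)"
    and range: "lam C \<in> {0..1}" "rho C \<in> {0..1}"
begin

lemma finite_A_B: "finite (A_set C)" "finite (B_set C)"
  using fin by (auto simp: A_set_def B_set_def)

lemma card_I_set: "card (I_set C) = card (A_set C) + card (B_set C)"
  unfolding I_set_eq by (rule card_Un_disjoint) (use finite_A_B A_B_disjoint in auto)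

text \<open>Summing \<open>\<lambda> \<le> D(w) \<le> \<rho>\<close> over I gives the first two
  conditions. Summing over A gives \<open>D(A) \<le> \<rho> |A|\<close>, and summing over B gives
  \<open>D(A) = 1 - D(B) \<le> 1 - \<lambda> |B|\<close>, while
  \<open>D(A) \<ge> 1 - \<epsilon>\<close>.\<close>

lemma feasible_imp_condition:
  assumes "feasible C"
  shows "feasibility_condition C"
proof -
  obtain D where D: "improvising_distribution C D"
    using assms by (auto simp: feasible_def)
  have prob: "measure_pmf.prob D S = sum (pmf D) S" if "S \<subseteq> I_set C" for S
    using that fin by (simp add: measure_measure_pmf_finite finite_subset)
  have bounds: "of_rat (lam C) * card S \<le> sum (pmf D) S \<and> sum (pmf D) S \<le> of_rat (rho C) * card S"
    if "S \<subseteq> I_set C" for S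
    using D that sum_bounded_below[of S "of_rat (lam C)" "pmf D"]
      sum_bounded_above[of S "pmf D" "of_rat (rho C)"]
    by (auto simp: improvising_distribution_def mult.commute)
  have sub: "A_set C \<subseteq> I_set C" "B_set C \<subseteq> I_set C" by (auto simp: A_set_def B_set_def)
  have total: "sum (pmf D) (I_set C) = 1"
    using D prob[of "I_set C"] by (simp add: improvising_distribution_def)
  have "sum (pmf D) (I_set C) = sum (pmf D) (A_set C) + sum (pmf D) (B_set C)"
    unfolding I_set_eq by (rule sum.union_disjoint) (use finite_A_B A_B_disjoint in auto)
  moreover have "1 - of_rat (eps C) \<le> sum (pmf D) (A_set C)"
    using D prob[OF sub(1)] by (simp add: improvising_distribution_def)
  ultimately show ?thesis
    using bounds[OF sub(1)] bounds[OF sub(2)] bounds[of "I_set C"] total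
    by (auto simp: feasibility_condition_def max_soft_prob_def card_I_set)
qed

context
  assumes cond: "feasibility_condition C"
begin

lemma max_soft_prob_range: "0 \<le> max_soft_prob C" "max_soft_prob C \<le> 1"
proof -
  let ?l = "of_rat (lam C) :: real" and ?r = "of_rat (rho C) :: real"
  have nonneg: "0 \<le> ?l" "0 \<le> ?r" using range by auto
  have "?l * real (card (A_set C)) \<ge> 0" using nonneg by simp
  then have "?l * real (card (B_set C)) \<le> 1"
    using cond by (simp add: feasibility_condition_def algebra_simps)
  then show "0 \<le> max_soft_prob C" using nonneg by (simp add: max_soft_prob_def)
  have "0 \<le> ?l * real (card (B_set C))" using nonneg by simp
  then show "max_soft_prob C \<le> 1" by (simp add: max_soft_prob_def)
qed

lemma A_set_nonempty: "max_soft_prob C > 0 \<Longrightarrow> A_set C \<noteq> {}"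
  by (auto simp: max_soft_prob_def)

text \<open>For empty B the second term of the minimum is 1, and \<open>1 \<le> \<rho> |A|\<close>.
  Together with the previous lemma this shows that the unspecified \<open>pmf_of_set {}\<close> can
  only occur with weight 0.\<close>

lemma B_set_nonempty: "max_soft_prob C < 1 \<Longrightarrow> B_set C \<noteq> {}"
  using cond by (auto simp: max_soft_prob_def feasibility_condition_def)

lemma pmf_soft_mixture:
  "pmf (soft_mixture C) w =
    max_soft_prob C * (indicator (A_set C) w / card (A_set C)) +
    (1 - max_soft_prob C) * (indicator (B_set C) w / card (B_set C))"
proof -
  have "max_soft_prob C * pmf (pmf_of_set (A_set C)) w =
      max_soft_prob C * (indicator (A_set C) w / card (A_set C))"
  proof (cases "A_set C = {}")
    case True
    then have "max_soft_prob C = 0" using A_set_nonempty max_soft_prob_range by force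
    then show ?thesis by simp
  qed (use finite_A_B in simp)
  moreover have "(1 - max_soft_prob C) * pmf (pmf_of_set (B_set C)) w =
      (1 - max_soft_prob C) * (indicator (B_set C) w / card (B_set C))"
  proof (cases "B_set C = {}")
    case True
    then have "max_soft_prob C = 1" using B_set_nonempty max_soft_prob_range by force
    then show ?thesis by simp
  qed (use finite_A_B in simp)
  ultimately show ?thesis
    using max_soft_prob_range by (simp add: soft_mixture_def pmf_bind mult.commute)
qed

lemma pmf_soft_mixture_A:
  "w \<in> A_set C \<Longrightarrow> pmf (soft_mixture C) w = max_soft_prob C / card (A_set C)"
  and pmf_soft_mixture_B:
  "w \<in> B_set C \<Longrightarrow> pmf (soft_mixture C) w = (1 - max_soft_prob C) / card (B_set C)"
  using A_B_disjoint[of C] by (auto simp: pmf_soft_mixture indicator_def)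

lemma set_pmf_soft_mixture: "set_pmf (soft_mixture C) \<subseteq> I_set C"
  by (auto simp: set_pmf_iff pmf_soft_mixture I_set_eq indicator_def split: if_splits)

lemma prob_A_soft_mixture: "measure_pmf.prob (soft_mixture C) (A_set C) = max_soft_prob C"
proof -
  have "measure_pmf.prob (soft_mixture C) (A_set C) =
      (\<Sum>w\<in>A_set C. max_soft_prob C / card (A_set C))"
    by (simp add: measure_measure_pmf_finite finite_A_B pmf_soft_mixture_A)
  also have "\<dots> = max_soft_prob C"
    using A_set_nonempty max_soft_prob_range finite_A_B by (cases "A_set C = {}") force+
  finally show ?thesis .
qed

lemma improvising_soft_mixture:
  assumes "lang (hard C) \<subseteq> lists (alphabet (hard C))"
  shows "improvising_distribution C (soft_mixture C)"
proof -
  let ?l = "of_rat (lam C) :: real" and ?r = "of_rat (rho C) :: real"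
  let ?a = "real (card (A_set C))" and ?b = "real (card (B_set C))" and ?p = "max_soft_prob C"
  have nonneg: "0 \<le> ?l" "0 \<le> ?r" using range by auto
  have c: "?l * ?a + ?l * ?b \<le> 1" "1 \<le> ?r * ?a + ?r * ?b"
    using cond by (simp_all add: feasibility_condition_def algebra_simps)
  \<comment> \<open>This follows from \<open>\<lambda> |I| \<le> 1 \<le> \<rho> |I|\<close>, where
    the second inequality makes |I| positive.\<close>
  have "?l \<le> ?r"
  proof (rule ccontr)
    assume "\<not> ?l \<le> ?r"
    then have "?r * (?a + ?b) \<le> ?l * (?a + ?b)" "?a + ?b > 0 \<Longrightarrow> ?r * (?a + ?b) < ?l * (?a + ?b)"
      by (auto intro!: mult_right_mono mult_strict_right_mono)
    moreover have "?a + ?b > 0"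
      using c(2) by (cases "?a = 0"; cases "?b = 0") (auto simp: add_pos_nonneg add_nonneg_pos)
    ultimately show False using c by (simp add: algebra_simps)
  qed
  then have "?l * ?a \<le> ?r * ?a" "?l * ?b \<le> ?r * ?b" by (auto intro: mult_right_mono)
  \<comment> \<open>Both values of the minimum are checked:
    \<open>1 - \<rho> |A| \<le> \<rho> |B|\<close> and
    \<open>\<lambda> |A| \<le> 1 - \<lambda> |B|\<close> come from the conditions on |I|, the rest
    from \<open>\<lambda> \<le> \<rho>\<close>. Dividing by |A| and |B| then yields the pointwise
    bounds.\<close>
  with c have p: "?l * ?a \<le> ?p" "?p \<le> ?r * ?a" "?l * ?b \<le> 1 - ?p" "1 - ?p \<le> ?r * ?b"
    by (auto simp: max_soft_prob_def min_def)
  have "?l \<le> pmf (soft_mixture C) w \<and> pmf (soft_mixture C) w \<le> ?r" if "w \<in> I_set C" for w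
  proof (cases "w \<in> A_set C")
    case True
    then have "?a > 0" using finite_A_B by (auto simp: card_gt_0_iff)
    then show ?thesis using p by (simp add: pmf_soft_mixture_A True field_simps)
  next
    case False
    then have w: "w \<in> B_set C" using that by (auto simp: I_set_eq)
    then have "?b > 0" using finite_A_B by (auto simp: card_gt_0_iff)
    then show ?thesis using p by (simp add: pmf_soft_mixture_B w field_simps)
  qed
  moreover have "measure_pmf.prob (soft_mixture C) (I_set C) = 1"
    using set_pmf_soft_mixture by (simp add: measure_pmf.prob_eq_1 AE_measure_pmf_iff subset_iff)
  moreover have "I_set C \<subseteq> lists (alphabet (hard C))" using assms by (auto simp: I_set_def)
  ultimately show ?thesis
    using set_pmf_soft_mixture cond
    by (simp add: improvising_distribution_def prob_A_soft_mixture feasibility_condition_def subset_trans)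
qed

end

lemma feasible_iff_condition:
  assumes "lang (hard C) \<subseteq> lists (alphabet (hard C))"
  shows "feasible C \<longleftrightarrow> feasibility_condition C"
  using feasible_imp_condition improvising_soft_mixture[OF _ assms] by (auto simp: feasible_def)

end

section \<open>The improviser and the scheme\<close>

lemma mean_time_shift:
  "(\<integral>\<^sup>+ x. of_nat (k + snd x) \<partial>measure_spmf (run p v)) \<le> of_nat k + mean_time p v"
proof -
  have "(\<integral>\<^sup>+ x. of_nat (k + snd x) \<partial>measure_spmf (run p v)) =
      (\<integral>\<^sup>+ x. of_nat k \<partial>measure_spmf (run p v)) + mean_time p v"
    unfolding mean_time_def of_nat_add by (rule nn_integral_add) auto
  also have "\<dots> \<le> of_nat k + mean_time p v"
    by (intro add_right_mono nn_integral_const_spmf_le)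
  finally show ?thesis .
qed

lemma mean_time_Seq_Op:
  "mean_time (Seq (Op i) p) v \<le> of_nat (2 + vsize v + vsize (step i v)) + mean_time p (step i v)"
  using mean_time_shift[where k = "2 + vsize v + vsize (step i v)" and p = p and v = "step i v"]
  by (simp add: mean_time_def[of "Seq _ _"] nn_integral_map_spmf case_prod_unfold o_def)

text \<open>The bound \<open>M\<close> is demanded only for outcomes of the test that can occur,
  because a branch whose sampler would face an empty language comes without any guarantee.\<close>

lemma mean_time_Cond:
  assumes "\<And>b. b \<in> set_spmf (map_spmf fst (run c v)) \<Longrightarrow> mean_time (if b = Num 0 then q else p) v \<le> M"
  shows "mean_time (Cond c p q) v \<le> of_nat (1 + vsize v) + mean_time c v + M"
proof -
  let ?b = "\<lambda>x. if fst x = Num 0 then q else p"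
  have "mean_time (Cond c p q) v = (\<integral>\<^sup>+ x. \<integral>\<^sup>+ y. of_nat ((1 + vsize v + snd x) + snd y)
      \<partial>measure_spmf (run (?b x) v) \<partial>measure_spmf (run c v))"
    unfolding mean_time_def run.simps nn_integral_bind_spmf
    by (intro nn_integral_cong) (auto simp: nn_integral_map_spmf case_prod_unfold o_def)
  also have "\<dots> \<le> (\<integral>\<^sup>+ x. of_nat (1 + vsize v + snd x) + M \<partial>measure_spmf (run c v))"
  proof (rule nn_integral_mono_AE)
    have "(\<integral>\<^sup>+ y. of_nat ((1 + vsize v + snd x) + snd y) \<partial>measure_spmf (run (?b x) v)) \<le>
        of_nat (1 + vsize v + snd x) + M" if "x \<in> set_spmf (run c v)" for x
      using assms[of "fst x"] that
      by (intro order_trans[OF mean_time_shift] add_left_mono) auto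
    then show "AE x in measure_spmf (run c v).
        (\<integral>\<^sup>+ y. of_nat ((1 + vsize v + snd x) + snd y) \<partial>measure_spmf (run (?b x) v)) \<le>
        of_nat (1 + vsize v + snd x) + M"
      by (simp add: AE_measure_spmf_iff)
  qed
  also have "\<dots> = (\<integral>\<^sup>+ x. of_nat (1 + vsize v + snd x) \<partial>measure_spmf (run c v)) +
      (\<integral>\<^sup>+ x. M \<partial>measure_spmf (run c v))"
    by (rule nn_integral_add) auto
  also have "\<dots> \<le> of_nat (1 + vsize v) + mean_time c v + M"
    by (intro add_mono mean_time_shift nn_integral_const_spmf_le)
  finally show ?thesis .
qed

text \<open>The input is a pair of the bias \<open>a / b\<close> and the two inputs for the sampler \<open>p\<close>;
  \<open>w\<close> tosses the biased coin.\<close>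

definition mixture_prog :: "prog \<Rightarrow> prog \<Rightarrow> prog" where
  "mixture_prog w p = Cond (Seq (Op Fst) w)
     (Seq (Op Snd) (Seq (Op Fst) p)) (Seq (Op Snd) (Seq (Op Snd) p))"

context
  fixes w p :: prog and a b :: nat and u v :: val and D E :: "val pmf"
    and mix :: "val pmf" and d :: val
  defines "d \<equiv> VPair (VPair (Num a) (Num b)) (VPair u v)"
  defines "mix \<equiv> bernoulli_pmf (a / b) \<bind> (\<lambda>h. if h then D else E)"
  assumes ab: "a \<le> b" "0 < b"
    and w: "map_spmf fst (run w (VPair (Num a) (Num b))) =
        spmf_of_pmf (map_pmf (\<lambda>h. Num (of_bool h)) (bernoulli_pmf (a / b)))"
    and D: "0 < a \<Longrightarrow> has_output_distribution p u D"
    and E: "a < b \<Longrightarrow> has_output_distribution p v E"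
begin

text \<open>A branch that is reached has positive weight, so the guarantee for its sampler, which is
  conditional on exactly this, applies.\<close>

lemma bernoulli_support: "h \<in> set_pmf (bernoulli_pmf (a / b)) \<Longrightarrow> if h then 0 < a else a < b"
  using ab by (cases h) (auto simp: set_pmf_iff intro!: Nat.gr0I le_neq_trans)

lemma map_fst_toss: "map_spmf fst (run (Seq (Op Fst) w) d) =
    spmf_of_pmf (map_pmf (\<lambda>h. Num (of_bool h)) (bernoulli_pmf (a / b)))"
  unfolding map_fst_run_Seq by (simp add: d_def w)

lemma mixture_prog_output:
  "has_output_distribution (Seq (Op (Const d)) (mixture_prog w p)) (Num 0) mix"
proof -
  have "map_spmf fst (run (Seq (Op (Const d)) (mixture_prog w p)) (Num 0)) =
      map_spmf fst (run (mixture_prog w p) d)"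
    unfolding map_fst_run_Seq by simp
  also have "\<dots> = bernoulli_pmf (a / b) \<bind> (\<lambda>h. map_spmf fst (run p (if h then u else v)))"
    unfolding mixture_prog_def map_fst_run_Cond map_fst_toss
    by (auto simp: bind_map_pmf d_def spmf.map_comp o_def case_prod_unfold intro!: bind_pmf_cong)
  also have "\<dots> = bernoulli_pmf (a / b) \<bind> (\<lambda>h. spmf_of_pmf (if h then D else E))"
    using bernoulli_support D E
    by (intro bind_pmf_cong refl) (auto simp: has_output_distribution_def split: if_splits)
  finally show ?thesis
    by (simp add: has_output_distribution_def mix_def spmf_of_pmf_bind)
qed

text \<open>With V the size of \<open>d\<close>, the polynomial \<open>[:10, 8:]\<close> adds up
  \<open>3 + V\<close> for loading \<open>d\<close>, \<open>1 + V\<close> for the conditional,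
  \<open>2 + 2 V\<close> for extracting the bias and \<open>4 + 4 V\<close> for extracting the input
  of the sampler.\<close>

lemma mixture_prog_time:
  fixes q q' :: "nat poly"
  assumes wt: "mean_time w (VPair (Num a) (Num b)) \<le> of_nat (poly q (vsize (VPair (Num a) (Num b))))"
    and ut: "0 < a \<Longrightarrow> expected_time p u \<le> of_nat (poly q' (vsize u))"
    and vt: "a < b \<Longrightarrow> expected_time p v \<le> of_nat (poly q' (vsize v))"
  shows "expected_time (Seq (Op (Const d)) (mixture_prog w p)) (Num 0) \<le>
    of_nat (poly ([:10, 8:] + q + q') (vsize d))"
proof -
  let ?V = "vsize d"
  have branch: "mean_time (Seq (Op Snd) (Seq (Op i) p)) d \<le> of_nat (4 + 4 * ?V + poly q' ?V)"
    if i: "step i (VPair u v) = x" "vsize x \<le> ?V" "mean_time p x \<le> of_nat (poly q' (vsize x))" for i x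
  proof -
    have "mean_time (Seq (Op Snd) (Seq (Op i) p)) d \<le>
        of_nat (2 + ?V + vsize (VPair u v)) + mean_time (Seq (Op i) p) (VPair u v)"
      using mean_time_Seq_Op[of Snd "Seq (Op i) p" d] by (simp add: d_def)
    also have "\<dots> \<le> of_nat (2 + ?V + vsize (VPair u v)) +
        (of_nat (2 + vsize (VPair u v) + vsize x) + of_nat (poly q' (vsize x)))"
      using mean_time_Seq_Op[of i p "VPair u v"] i
      by (intro add_left_mono) (meson add_left_mono order_trans)
    also have "\<dots> = of_nat (2 + ?V + vsize (VPair u v) + (2 + vsize (VPair u v) + vsize x) + poly q' (vsize x))"
      by (simp add: add.assoc)
    also have "\<dots> \<le> of_nat (4 + 4 * ?V + poly q' ?V)"
    proof (intro of_nat_mono)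
      have "vsize (VPair u v) \<le> ?V" by (simp add: d_def)
      then show "2 + ?V + vsize (VPair u v) + (2 + vsize (VPair u v) + vsize x) + poly q' (vsize x) \<le>
          4 + 4 * ?V + poly q' ?V"
        using i(2) poly_nat_mono[OF i(2), of q'] by linarith
    qed
    finally show ?thesis .
  qed
  have u: "mean_time p u \<le> of_nat (poly q' (vsize u))" if "0 < a"
    using expected_time_eq_mean_time[OF D] ut that by simp
  have v: "mean_time p v \<le> of_nat (poly q' (vsize v))" if "a < b"
    using expected_time_eq_mean_time[OF E] vt that by simp
  have toss: "mean_time (Seq (Op Fst) w) d \<le> of_nat (2 + 2 * ?V + poly q ?V)"
  proof -
    let ?x = "VPair (Num a) (Num b)"
    have "mean_time (Seq (Op Fst) w) d \<le> of_nat (2 + ?V + vsize ?x) + of_nat (poly q (vsize ?x))"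
      using mean_time_Seq_Op[of Fst w d] wt unfolding d_def step.simps
      by (meson add_left_mono order_trans)
    also have "\<dots> \<le> of_nat (2 + 2 * ?V + poly q ?V)"
    proof -
      have x: "vsize ?x \<le> ?V" by (simp add: d_def)
      then show ?thesis
        unfolding of_nat_add[symmetric] using poly_nat_mono[OF x, of q]
        by (intro of_nat_mono) linarith
    qed
    finally show ?thesis .
  qed
  have "mean_time (mixture_prog w p) d \<le>
      of_nat (1 + ?V) + mean_time (Seq (Op Fst) w) d + of_nat (4 + 4 * ?V + poly q' ?V)"
    unfolding mixture_prog_def
  proof (rule mean_time_Cond)
    fix r assume "r \<in> set_spmf (map_spmf fst (run (Seq (Op Fst) w) d))"
    then obtain h where h: "h \<in> set_pmf (bernoulli_pmf (a / b))" "r = Num (of_bool h)"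
      unfolding map_fst_toss by auto
    show "mean_time (if r = Num 0 then Seq (Op Snd) (Seq (Op Snd) p) else Seq (Op Snd) (Seq (Op Fst) p)) d
        \<le> of_nat (4 + 4 * ?V + poly q' ?V)"
      using branch[of Fst u] branch[of Snd v] u v bernoulli_support[OF h(1)] h(2)
      by (cases h) (auto simp: d_def)
  qed
  also have "\<dots> \<le> of_nat (1 + ?V) + of_nat (2 + 2 * ?V + poly q ?V) + of_nat (4 + 4 * ?V + poly q' ?V)"
    using toss by (intro add_left_mono add_right_mono)
  also have "\<dots> = of_nat (7 + 7 * ?V + poly q ?V + poly q' ?V)"
    unfolding of_nat_add[symmetric] by (rule arg_cong[where f = of_nat]) simp
  finally have *: "mean_time (mixture_prog w p) d \<le> of_nat (7 + 7 * ?V + poly q ?V + poly q' ?V)" .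
  have "expected_time (Seq (Op (Const d)) (mixture_prog w p)) (Num 0) \<le>
      of_nat (2 + vsize (Num 0) + ?V) + of_nat (7 + 7 * ?V + poly q ?V + poly q' ?V)"
    unfolding expected_time_eq_mean_time[OF mixture_prog_output]
    using mean_time_Seq_Op[of "Const d" "mixture_prog w p" "Num 0"] *
    by (metis (no_types, lifting) add_left_mono order_trans step.simps(2))
  also have "\<dots> = of_nat (poly ([:10, 8:] + q + q') ?V)"
    unfolding of_nat_add[symmetric] by (rule arg_cong[where f = of_nat]) (simp add: floorlog_def)
  finally show ?thesis .
qed

end

section \<open>Rational parameters as fractions of natural numbers\<close>

definition rat_num :: "rat \<Rightarrow> nat" where "rat_num x = nat (fst (quotient_of x))"
definition rat_den :: "rat \<Rightarrow> nat" where "rat_den x = nat (snd (quotient_of x))"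

lemma rat_den_pos: "0 < rat_den x"
  by (simp add: rat_den_def quotient_of_denom_pos')

lemma of_rat_eq_num_den:
  assumes "0 \<le> x"
  shows "of_rat x = real (rat_num x) / real (rat_den x)"
proof -
  obtain n d where q: "quotient_of x = (n, d)" by fastforce
  have x: "x = of_int n / of_int d" and d: "0 < d"
    using quotient_of_div[OF q] quotient_of_denom_pos[OF q] by auto
  have n: "0 \<le> n" using assms d by (simp add: x zero_le_divide_iff)
  have "of_rat x = real_of_int n / real_of_int d" by (simp add: x of_rat_divide)
  then show ?thesis using n d by (simp add: rat_num_def rat_den_def q)
qed

lemma enc_rat_eq: "enc_rat x = VPair (Num (rat_num x)) (Num (rat_den x))"
  by (simp add: enc_rat_def rat_num_def rat_den_def)

text \<open>For operations that return specifications: the result is chosen as a specification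
  \<open>Z x\<close> and not merely as its representation, so that the next operation can be applied
  to it. \<open>Q\<close> is what is remembered about it.\<close>

lemma poly_time_task_spec:
  assumes "poly_time_fun enc D f" "poly_time_task enc' D' good"
    and "\<And>x. x \<in> D \<Longrightarrow> h x \<in> D' \<and> f x = enc' (h x)"
    and good: "\<And>x r. x \<in> D \<Longrightarrow> good (h x) r \<Longrightarrow> \<exists>Z\<in>Spec. r = repr Z \<and> Q x Z"
  obtains Z where "\<And>x. x \<in> D \<Longrightarrow> Z x \<in> Spec \<and> Q x (Z x)" "poly_time_fun enc D (\<lambda>x. repr (Z x))"
proof -
  obtain g where g: "poly_time_fun enc D g" "\<And>x. x \<in> D \<Longrightarrow> good (h x) (g x)"
    using poly_time_task_comp[OF assms(1-3)] by blast
  have "\<exists>Z. \<forall>x\<in>D. Z x \<in> Spec \<and> g x = repr (Z x) \<and> Q x (Z x)"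
    by (rule bchoice) (use good g(2) in blast)
  then obtain Z where "\<And>x. x \<in> D \<Longrightarrow> Z x \<in> Spec \<and> g x = repr (Z x) \<and> Q x (Z x)" by blast
  then show ?thesis
    using that[of Z] poly_time_fun_cong[OF g(1), of "\<lambda>x. repr (Z x)"] by simp
qed

text \<open>Numerator and denominator of \<^const>\<open>max_soft_prob\<close>. The truncated subtraction is exact
  if \<open>\<lambda> |I| \<le> 1\<close>.\<close>

definition soft_first :: "ci_instance \<Rightarrow> bool" where
  "soft_first C \<longleftrightarrow>
    rat_den (rho C) * (rat_den (lam C) - rat_num (lam C) * card (B_set C)) <
    rat_num (rho C) * card (A_set C) * rat_den (lam C)"

definition soft_num :: "ci_instance \<Rightarrow> nat" where
  "soft_num C = (if soft_first C then rat_den (lam C) - rat_num (lam C) * card (B_set C)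
    else rat_num (rho C) * card (A_set C))"

definition soft_den :: "ci_instance \<Rightarrow> nat" where
  "soft_den C = (if soft_first C then rat_den (lam C) else rat_den (rho C))"

lemma soft_den_pos: "0 < soft_den C"
  by (simp add: soft_den_def rat_den_pos)

lemma max_soft_prob_eq_frac:
  assumes "0 \<le> lam C" "0 \<le> rho C" "of_rat (lam C) * real (card (A_set C) + card (B_set C)) \<le> 1"
  shows "max_soft_prob C = soft_num C / soft_den C"
proof -
  define l1 l2 r1 r2 a b where defs: "l1 = rat_num (lam C)" "l2 = rat_den (lam C)"
    "r1 = rat_num (rho C)" "r2 = rat_den (rho C)" "a = card (A_set C)" "b = card (B_set C)"
  have pos: "0 < l2" "0 < r2" by (simp_all add: defs rat_den_pos)
  have "real l1 / real l2 * (real a + real b) \<le> 1"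
    using assms of_rat_eq_num_den[of "lam C"] by (simp add: defs)
  then have "real (l1 * (a + b)) \<le> real l2"
    using pos by (simp add: field_simps)
  then have "l1 * (a + b) \<le> l2" by (simp only: of_nat_le_iff)
  then have b: "l1 * b \<le> l2" by (simp add: algebra_simps)
  have diff: "1 - real l1 / real l2 * real b = real (l2 - l1 * b) / real l2"
    using b pos by (simp add: of_nat_diff field_simps)
  have prob: "max_soft_prob C = min (real r1 / real r2 * real a) (real (l2 - l1 * b) / real l2)"
    using assms of_rat_eq_num_den[of "lam C"] of_rat_eq_num_den[of "rho C"] diff
    by (simp add: max_soft_prob_def defs)
  \<comment> \<open>Clearing the positive denominators shows that \<open>soft_first\<close> selects
    the second term of the minimum exactly if it is strictly smaller.\<close>
  have "soft_first C \<longleftrightarrow> real (r2 * (l2 - l1 * b)) < real (r1 * a * l2)"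
    by (simp only: soft_first_def defs of_nat_less_iff)
  also have "\<dots> \<longleftrightarrow> real (l2 - l1 * b) / real l2 < real r1 / real r2 * real a"
    using pos by (simp add: field_simps del: of_nat_diff)
  finally show ?thesis
    unfolding prob by (auto simp: soft_num_def soft_den_def min_def simp flip: defs)
qed

text \<open>Denominators are cleared and each inequality is negated into a strict one, the form that
  \<open>Less\<close> decides. The third conjunct is translated only under the first, where
  \<open>soft_num C / soft_den C\<close> is known to be \<open>max_soft_prob C\<close>.\<close>

lemma feasibility_condition_iff:
  assumes "0 \<le> lam C" "0 \<le> rho C" "0 \<le> eps C"
  defines "k \<equiv> card (A_set C) + card (B_set C)"
  shows "feasibility_condition C \<longleftrightarrow>
    \<not> rat_den (lam C) < rat_num (lam C) * k \<and> \<not> rat_num (rho C) * k < rat_den (rho C) \<and>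
    \<not> soft_num C * rat_den (eps C) + rat_num (eps C) * soft_den C < rat_den (eps C) * soft_den C"
proof -
  define l1 l2 r1 r2 e1 e2 where defs: "l1 = rat_num (lam C)" "l2 = rat_den (lam C)"
    "r1 = rat_num (rho C)" "r2 = rat_den (rho C)" "e1 = rat_num (eps C)" "e2 = rat_den (eps C)"
  have pos: "0 < l2" "0 < r2" "0 < e2" "0 < soft_den C" by (simp_all add: defs rat_den_pos soft_den_pos)
  have frac: "of_rat (lam C) = real l1 / real l2" "of_rat (rho C) = real r1 / real r2"
      "of_rat (eps C) = real e1 / real e2"
    using assms(1-3) by (simp_all add: defs of_rat_eq_num_den)
  have "of_rat (lam C) * real k \<le> 1 \<longleftrightarrow> real (l1 * k) \<le> real l2"
    using pos unfolding frac by (simp add: field_simps)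
  then have l: "of_rat (lam C) * real k \<le> 1 \<longleftrightarrow> \<not> l2 < l1 * k" by (simp only: of_nat_le_iff not_less)
  have "1 \<le> of_rat (rho C) * real k \<longleftrightarrow> real r2 \<le> real (r1 * k)"
    using pos unfolding frac by (simp add: field_simps)
  then have r: "1 \<le> of_rat (rho C) * real k \<longleftrightarrow> \<not> r1 * k < r2" by (simp only: of_nat_le_iff not_less)
  have "1 - of_rat (eps C) \<le> max_soft_prob C \<longleftrightarrow> \<not> soft_num C * e2 + e1 * soft_den C < e2 * soft_den C"
    if "of_rat (lam C) * real k \<le> 1"
  proof -
    have "1 - of_rat (eps C) \<le> max_soft_prob C \<longleftrightarrow>
        1 - real e1 / real e2 \<le> real (soft_num C) / real (soft_den C)"
      using max_soft_prob_eq_frac[OF assms(1,2)] that unfolding k_def frac(3) by simp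
    also have "\<dots> \<longleftrightarrow> real (e2 * soft_den C) \<le> real (soft_num C * e2 + e1 * soft_den C)"
      using pos by (simp add: field_simps)
    finally show ?thesis by (simp only: of_nat_le_iff not_less)
  qed
  then show ?thesis
    using l r unfolding feasibility_condition_def k_def[symmetric] defs[symmetric] by blast
qed

lemma finite_I_set:
  assumes "finite (alphabet (hard C))" "lang (hard C) \<subseteq> lists (alphabet (hard C))"
  shows "finite (I_set C)"
  by (rule finite_subset[OF _ finite_lists_length_le[OF assms(1), of "max_len C"]])
    (use assms(2) in \<open>auto simp: I_set_def\<close>)

theorem theorem3p4:
  fixes Spec :: "spec set"
  assumes "spec_class Spec"
    and "poly_time_intersection Spec"
    and "poly_time_difference Spec"
    and "poly_time_length_restriction Spec"
    and "poly_time_counting Spec"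
    and "poly_time_uniform_sampling Spec"
  shows "\<exists>S. poly_time_improvisation_scheme (CI Spec Spec) S"
proof -
  let ?D = "CI Spec Spec"
  let ?ptf = "poly_time_fun inst_code ?D"
  have spec: "hard C \<in> Spec" "soft C \<in> Spec" "alphabet (hard C) = alphabet (soft C)"
    and nonneg: "0 \<le> lam C" "0 \<le> rho C" "0 \<le> eps C"
    and range: "lam C \<in> {0..1}" "rho C \<in> {0..1}" if "C \<in> ?D" for C
    using that by (auto simp: CI_def)
  have words: "lang (hard C) \<subseteq> lists (alphabet (hard C))" and fin: "finite (I_set C)" if "C \<in> ?D" for C
    using assms(1) spec(1)[OF that] finite_I_set[of C] by (auto simp: spec_class_def)

  \<comment> \<open>Reading the parameters of an instance\<close>
  have input: "?ptf (\<lambda>C. VPair (repr (hard C)) (VPair (repr (soft C)) (VPair (unary (min_len C))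
      (VPair (unary (max_len C)) (VPair (VPair (Num (rat_num (eps C))) (Num (rat_den (eps C))))
      (VPair (VPair (Num (rat_num (lam C))) (Num (rat_den (lam C))))
      (VPair (VPair (Num (rat_num (rho C))) (Num (rat_den (rho C)))) (Num 0))))))))"
    by (rule poly_time_fun_cong[OF poly_time_fun_self]) (simp add: inst_code_def enc_rat_eq)
  note input1 = poly_time_fun_snd[OF input] note input2 = poly_time_fun_snd[OF input1]
  note input3 = poly_time_fun_snd[OF input2] note input4 = poly_time_fun_snd[OF input3]
  note input5 = poly_time_fun_snd[OF input4] note input6 = poly_time_fun_snd[OF input5]
  \<comment> \<open>The order is: hard and soft specification, minimal and maximal length, then
    numerator and denominator of \<epsilon>, of \<lambda> and of \<rho>.\<close>
  note params = poly_time_fun_fst[OF input] poly_time_fun_fst[OF input1]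
    poly_time_fun_fst[OF input2] poly_time_fun_fst[OF input3]
    poly_time_fun_fst[OF poly_time_fun_fst[OF input4]] poly_time_fun_snd[OF poly_time_fun_fst[OF input4]]
    poly_time_fun_fst[OF poly_time_fun_fst[OF input5]] poly_time_fun_snd[OF poly_time_fun_fst[OF input5]]
    poly_time_fun_fst[OF poly_time_fun_fst[OF input6]] poly_time_fun_snd[OF poly_time_fun_fst[OF input6]]

  \<comment> \<open>Specifications of I, A and B, and their sizes\<close>
  obtain X where X: "\<And>C. C \<in> ?D \<Longrightarrow> X C \<in> Spec \<and> alphabet (X C) = alphabet (hard C) \<and> lang (X C) = I_set C"
    and X_ptf: "?ptf (\<lambda>C. repr (X C))"
    by (rule poly_time_task_spec[OF _ assms(4)[unfolded poly_time_length_restriction_def],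
        where h = "\<lambda>C. (hard C, min_len C, max_len C)" and Spec = Spec and
        Q = "\<lambda>C X. alphabet X = alphabet (hard C) \<and> lang X = I_set C",
        OF poly_time_fun_VPair[OF params(1) poly_time_fun_VPair[OF params(3,4)]]])
      (auto simp: spec I_set_def)
  \<comment> \<open>Intersection and difference require a common alphabet, which is why the alphabet
    of \<open>X C\<close> was recorded above.\<close>
  obtain Y where Y: "\<And>C. C \<in> ?D \<Longrightarrow> Y C \<in> Spec \<and> lang (Y C) = A_set C"
    and Y_ptf: "?ptf (\<lambda>C. repr (Y C))"
    by (rule poly_time_task_spec[OF _ assms(2)[unfolded poly_time_intersection_def],
        where h = "\<lambda>C. (X C, soft C)" and Spec = Spec and Q = "\<lambda>C Y. lang Y = A_set C",
        OF poly_time_fun_VPair[OF X_ptf params(2)]])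
      (use X spec in \<open>auto simp: A_set_def\<close>)
  obtain Z where Z: "\<And>C. C \<in> ?D \<Longrightarrow> Z C \<in> Spec \<and> lang (Z C) = B_set C"
    and Z_ptf: "?ptf (\<lambda>C. repr (Z C))"
    by (rule poly_time_task_spec[OF _ assms(3)[unfolded poly_time_difference_def],
        where h = "\<lambda>C. (X C, soft C)" and Spec = Spec and Q = "\<lambda>C Z. lang Z = B_set C",
        OF poly_time_fun_VPair[OF X_ptf params(2)]])
      (use X spec in \<open>auto simp: B_set_def\<close>)
  have bound: "length_bound (Y C) (max_len C)" "length_bound (Z C) (max_len C)" if "C \<in> ?D" for C
    using Y[OF that] Z[OF that] by (auto simp: length_bound_def A_set_def B_set_def I_set_def)
  note YN = poly_time_fun_VPair[OF Y_ptf params(4)] and ZN = poly_time_fun_VPair[OF Z_ptf params(4)]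
  have card_A: "?ptf (\<lambda>C. Num (card (A_set C)))"
    by (rule poly_time_task_comp[OF YN assms(5)[unfolded poly_time_counting_def],
        where h = "\<lambda>C. (Y C, max_len C)"])
      (use Y bound in \<open>auto intro: poly_time_fun_cong\<close>)
  have card_B: "?ptf (\<lambda>C. Num (card (B_set C)))"
    by (rule poly_time_task_comp[OF ZN assms(5)[unfolded poly_time_counting_def],
        where h = "\<lambda>C. (Z C, max_len C)"])
      (use Z bound in \<open>auto intro: poly_time_fun_cong\<close>)

  \<comment> \<open>The bias as a fraction\<close>
  note first = poly_time_fun_less[OF poly_time_fun_mult[OF params(10)
        poly_time_fun_diff[OF params(8) poly_time_fun_mult[OF params(7) card_B]]]
      poly_time_fun_mult[OF poly_time_fun_mult[OF params(9) card_A] params(8)], folded soft_first_def]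
  have num: "?ptf (\<lambda>C. Num (soft_num C))"
    by (rule poly_time_fun_cong[OF poly_time_fun_If[OF first
          poly_time_fun_diff[OF params(8) poly_time_fun_mult[OF params(7) card_B]]
          poly_time_fun_mult[OF params(9) card_A]]]) (simp add: soft_num_def)
  have den: "?ptf (\<lambda>C. Num (soft_den C))"
    by (rule poly_time_fun_cong[OF poly_time_fun_If[OF first params(8,10)]]) (simp add: soft_den_def)

  \<comment> \<open>The improviser and the computation of its text\<close>
  obtain w qw where w: "\<And>a b. a \<le> b \<Longrightarrow> 0 < b \<Longrightarrow> map_spmf fst (run w (VPair (Num a) (Num b))) =
        spmf_of_pmf (map_pmf (\<lambda>h. Num (of_bool h)) (bernoulli_pmf (a / b)))"
    "\<And>a b. a \<le> b \<Longrightarrow> 0 < b \<Longrightarrow>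
        mean_time w (VPair (Num a) (Num b)) \<le> of_nat (poly qw (vsize (VPair (Num a) (Num b))))"
    using poly_time_bernoulli by metis
  obtain p qp where p: "\<And>X n. X \<in> Spec \<Longrightarrow> length_bound X n \<Longrightarrow> lang X \<noteq> {} \<Longrightarrow>
      has_output_distribution p (VPair (repr X) (unary n)) (map_pmf enc_word (pmf_of_set (lang X))) \<and>
      expected_time p (VPair (repr X) (unary n)) \<le> of_nat (poly qp (vsize (VPair (repr X) (unary n))))"
    using assms(6) unfolding poly_time_uniform_sampling_def Let_def by metis

  define data where "data C = VPair (VPair (Num (soft_num C)) (Num (soft_den C)))
    (VPair (VPair (repr (Y C)) (unary (max_len C))) (VPair (repr (Z C)) (unary (max_len C))))" for C
  have data_ptf: "?ptf data"
    unfolding data_def by (rule poly_time_fun_VPair[OF poly_time_fun_VPair[OF num den] poly_time_fun_VPair[OF YN ZN]])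
  define G where "G C = Seq (Op (Const (data C))) (mixture_prog w p)" for C
  \<comment> \<open>Only the argument of \<open>Const\<close> varies with the instance; the rest of
    the text is a fixed value, so the text is computed by pairing.\<close>
  have G_code: "prog_code (G C) = VPair (Num 2) (VPair (VPair (Num 0) (VPair (Num 1) (data C)))
      (prog_code (mixture_prog w p)))" for C
    by (simp add: G_def)
  have G_ptf: "?ptf (\<lambda>C. prog_code (G C))"
    unfolding G_code by (intro poly_time_fun_VPair poly_time_fun_const data_ptf)

  note k = poly_time_fun_add[OF card_A card_B]
  define out where "out C = (if feasibility_condition C then prog_code (G C) else bottom)" for C
  \<comment> \<open>These decide the three inequalities that are negated in
    \<open>feasibility_condition_iff\<close>; as soon as one of them holds, the output is
    \<open>bottom\<close>.\<close>
  note tests = poly_time_fun_less[OF params(8) poly_time_fun_mult[OF params(7) k]]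
    poly_time_fun_less[OF poly_time_fun_mult[OF params(9) k] params(10)]
    poly_time_fun_less[OF poly_time_fun_add[OF poly_time_fun_mult[OF num params(6)]
        poly_time_fun_mult[OF params(5) den]] poly_time_fun_mult[OF params(6) den]]
  have "?ptf out"
    by (rule poly_time_fun_cong[OF poly_time_fun_If[OF tests(1) poly_time_fun_const[of _ _ bottom]
          poly_time_fun_If[OF tests(2) poly_time_fun_const[of _ _ bottom]
          poly_time_fun_If[OF tests(3) poly_time_fun_const[of _ _ bottom] G_ptf]]]])
      (simp add: out_def feasibility_condition_iff nonneg)
  then obtain S qS where S: "\<And>C. C \<in> ?D \<Longrightarrow>
      \<exists>t. computes S (inst_code C) (out C) t \<and> t \<le> poly qS (vsize (inst_code C))"
    using poly_time_funE by blast
  obtain qd where qd: "\<And>C. C \<in> ?D \<Longrightarrow> vsize (data C) \<le> poly qd (vsize (inst_code C))"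
    using poly_time_fun_vsize[OF data_ptf] by blast

  \<comment> \<open>Output distribution and expected time of the improviser\<close>
  have G: "improvising_distribution C (soft_mixture C)"
    "has_output_distribution (G C) (Num 0) (map_pmf enc_word (soft_mixture C))"
    "expected_time (G C) (Num 0) \<le> of_nat (poly ([:10, 8:] + qw + qp) (vsize (data C)))"
    if C: "C \<in> ?D" and cond: "feasibility_condition C" for C
  proof -
    note fr = fin[OF C] range[OF C]
    have prob: "max_soft_prob C = soft_num C / soft_den C"
      using max_soft_prob_eq_frac[OF nonneg(1,2)[OF C]] cond by (simp add: feasibility_condition_def)
    have frac: "soft_num C \<le> soft_den C"
      using max_soft_prob_range(2)[OF fr cond] soft_den_pos[of C] by (simp add: prob)
    \<comment> \<open>Positive weight makes the set nonempty, which is the precondition of the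
      sampler; the same holds for B below.\<close>
    have A: "A_set C \<noteq> {}" if "0 < soft_num C"
      by (rule A_set_nonempty[OF fr cond]) (use that soft_den_pos[of C] in \<open>simp add: prob\<close>)
    have B: "B_set C \<noteq> {}" if "soft_num C < soft_den C"
      by (rule B_set_nonempty[OF fr cond]) (use that in \<open>simp add: prob\<close>)
    have pA: "has_output_distribution p (VPair (repr (Y C)) (unary (max_len C)))
        (map_pmf enc_word (pmf_of_set (A_set C)))"
      "expected_time p (VPair (repr (Y C)) (unary (max_len C))) \<le>
        of_nat (poly qp (vsize (VPair (repr (Y C)) (unary (max_len C)))))" if "0 < soft_num C"
      using p[of "Y C" "max_len C"] Y[OF C] bound(1)[OF C] A[OF that] by auto
    have pB: "has_output_distribution p (VPair (repr (Z C)) (unary (max_len C)))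
        (map_pmf enc_word (pmf_of_set (B_set C)))"
      "expected_time p (VPair (repr (Z C)) (unary (max_len C))) \<le>
        of_nat (poly qp (vsize (VPair (repr (Z C)) (unary (max_len C)))))" if "soft_num C < soft_den C"
      using p[of "Z C" "max_len C"] Z[OF C] bound(2)[OF C] B[OF that] by auto
    show "improvising_distribution C (soft_mixture C)"
      by (rule improvising_soft_mixture[OF fr cond words[OF C]])
    show "has_output_distribution (G C) (Num 0) (map_pmf enc_word (soft_mixture C))"
      using mixture_prog_output[OF frac soft_den_pos w(1)[OF frac soft_den_pos] pA(1) pB(1)]
      by (simp add: G_def data_def soft_mixture_def prob map_bind_pmf if_distrib)
    show "expected_time (G C) (Num 0) \<le> of_nat (poly ([:10, 8:] + qw + qp) (vsize (data C)))"
      unfolding G_def data_def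
      by (rule mixture_prog_time[OF frac soft_den_pos w(1)[OF frac soft_den_pos] pA(1) pB(1)
            w(2)[OF frac soft_den_pos] pA(2) pB(2)])
  qed
  have feasible: "feasible C \<longleftrightarrow> feasibility_condition C" if "C \<in> ?D" for C
    by (rule feasible_iff_condition[OF fin[OF that] range[OF that] words[OF that]])

  \<comment> \<open>The three requirements on the scheme\<close>
  have "scheme_correct ?D S"
    unfolding scheme_correct_def
  proof (intro ballI conjI impI)
    fix C assume C: "C \<in> ?D" and "feasible C"
    then have cond: "feasibility_condition C" using feasible by simp
    have "improviser C (G C)"
      using G[OF C cond] unfolding improviser_def
      by (metis ennreal_of_nat_eq_real_of_nat ennreal_less_top infinity_ennreal_def le_less_trans)
    then show "\<exists>G t. computes S (inst_code C) (prog_code G) t \<and> improviser C G"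
      using S[OF C] cond by (auto simp: out_def)
  next
    fix C assume "C \<in> ?D" "\<not> feasible C"
    then show "\<exists>t. computes S (inst_code C) bottom t"
      using S[of C] feasible[of C] by (auto simp: out_def)
  qed
  moreover have "scheme_efficient ?D S"
    unfolding scheme_efficient_def inst_size_def using S by blast
  moreover have "improvisers_efficient ?D S"
    unfolding improvisers_efficient_def
  proof (intro exI ballI allI impI)
    fix C H t assume C: "C \<in> ?D" and "computes S (inst_code C) (prog_code H) t"
    \<comment> \<open>The output of the scheme is unique, and program texts are injective and differ
      from \<open>bottom\<close>; so \<open>H\<close> can only be the program \<open>G C\<close> of
      a feasible instance.\<close>
    then have "prog_code H = out C" using S[OF C] computes_fun by blast
    then have cond: "feasibility_condition C" and H: "H = G C"
      by (auto simp: out_def prog_code_neq_bottom prog_code_inject split: if_splits)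
    have "expected_time H (Num 0) \<le> of_nat (poly ([:10, 8:] + qw + qp) (vsize (data C)))"
      using G(3)[OF C cond] by (simp only: H)
    \<comment> \<open>The bound is in terms of the inserted constant, whose size is polynomial in
      that of the instance because it is computed in polynomial time.\<close>
    also have "\<dots> \<le> of_nat (poly (pcompose ([:10, 8:] + qw + qp) qd) (inst_size C))"
      unfolding poly_pcompose inst_size_def by (intro of_nat_mono poly_nat_mono qd C)
    finally show "expected_time H (Num 0) \<le>
        of_nat (poly (pcompose ([:10, 8:] + qw + qp) qd) (inst_size C))" .
  qed
  ultimately show ?thesis
    unfolding poly_time_improvisation_scheme_def by blast
qed

end
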